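(* Let $d$ be a fixed constant, let $\delta\in(0,1)$ and $\rho>0$ be arbitrary constants, and let $c,c_0$ be suitable constants. Let $\alpha$ be an arbitrary integer with $1\le\alpha\le\log^*n-c_0$ and let $r$ be an arbitrary positive real. Let $P$ be any set of $n$ points in $\mathbb{R}^d$ and let $\mathcal{C}_r$ be a clustering of $P$ that has the minimum number of clusters among all clusterings of $P$ with cost at most $r$, and suppose $|\mathcal{C}_r|=\Omega((\log n)^c)$. There exists an MPC algorithm that, with probability at least $1-\frac{1}{(\log^{(\alpha-1)}n)^{\Omega(1)}}$, in $\mathcal{O}(\log\log n)$ rounds determines a set $T\subseteq P$ of centers such that $\mathrm{COST}(P,T)=\mathcal{O}\big(r\cdot(\alpha+\log^{(\alpha+1)}n)\big)$ and $$|T|\le|\mathcal{C}_r|\cdot\Big(1+\frac{1}{\widetilde{\Theta}(\log^{(\alpha)}n)}\Big)+\widetilde{\Theta}\big((\log^{(\alpha)}n)^3\big).$$ The MPC uses local space $\mathcal{S}=\mathcal{O}(n^\delta)$ and global space $\mathcal{T}=\widetilde{\mathcal{O}}(n^{1+\rho}\cdot\log\Delta)$.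
   Context: MPC model: $\mathcal{M}$ machines, each with $\mathcal{S}$ words of local memory; global space $\mathcal{T}=\mathcal{S}\cdot\mathcal{M}$; synchronous rounds of local computation followed by message exchange, each machine sending and receiving at most $\mathcal{S}$ words per round. Distances are Euclidean; $d(p,S)=\min_{q\in S}d(p,q)$; $\mathrm{COST}(P,S)=\max_{p\in P}d(p,S)$. A clustering of $P$ is a partition of $P$ into nonempty clusters; the radius of a cluster $C$ is $\min_{x\in C}\max_{y\in C}d(x,y)$, and the cost of a clustering is the maximum radius of its clusters. The input is rescaled so the minimum pairwise distance in $P$ is $1$; $\Delta$ is the maximum pairwise distance. $\log^{(i)}n$ is the $i$-fold iterated logarithm ($\log^{(0)}n=n$); $\log^*n$ the iterated logarithm. $\widetilde{\mathcal{O}}(f),\widetilde{\Theta}(f)$ hide factors polynomial in $\log f$. *)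

theory Defs
  imports
    "HOL-Analysis.Analysis"
    "HOL-Probability.Product_PMF"
    "HOL-Library.Disjoint_Sets"
begin

section \<open>Iterated logarithms and soft asymptotics\<close>

fun ilog :: "nat \<Rightarrow> real \<Rightarrow> real" where
  "ilog 0 x = x"
| "ilog (Suc i) x = log 2 (ilog i x)"

definition log_star :: "real \<Rightarrow> nat" where
  "log_star x = (LEAST i. ilog i x \<le> 1)"

text \<open>
  One hidden constant \<open>C\<close> serves both as the factor and as the degree of the polynomial in
  \<open>log f\<close>. The predicates are meant for arguments \<open>f\<close> with \<open>log 2 f \<ge> 1\<close> and are used
  pointwise, with \<open>C\<close> quantified before everything that must not influence it.
\<close>

definition soft_O :: "real \<Rightarrow> real \<Rightarrow> real \<Rightarrow> bool" where
  "soft_O C f y \<longleftrightarrow> y \<le> C * f * log 2 f powr C"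

definition soft_Theta :: "real \<Rightarrow> real \<Rightarrow> real \<Rightarrow> bool" where
  "soft_Theta C f y \<longleftrightarrow> f / (C * log 2 f powr C) \<le> y \<and> soft_O C f y"

section \<open>Centres and clusterings\<close>

text \<open>The point sets are finite; \<open>T\<close> must be nonempty for \<open>COST P T\<close> to be meaningful.\<close>

definition COST :: "'a::metric_space set \<Rightarrow> 'a set \<Rightarrow> real" where
  "COST P T = Max ((\<lambda>p. Min (dist p ` T)) ` P)"

definition cluster_radius :: "'a::metric_space set \<Rightarrow> real" where
  "cluster_radius C = Min ((\<lambda>x. Max (dist x ` C)) ` C)"

definition clustering_cost :: "'a::metric_space set set \<Rightarrow> real" where
  "clustering_cost \<C> = Max (cluster_radius ` \<C>)"

definition min_clustering :: "'a::metric_space set \<Rightarrow> real \<Rightarrow> 'a set set \<Rightarrow> bool" where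
  "min_clustering P r \<C> \<longleftrightarrow>
     is_arg_min card (\<lambda>\<D>. partition_on P \<D> \<and> clustering_cost \<D> \<le> r) \<C>"

definition min_distance :: "'a::metric_space set \<Rightarrow> real" where
  "min_distance P = Min {dist x y | x y. x \<in> P \<and> y \<in> P \<and> x \<noteq> y}"

section \<open>The MPC model\<close>

text \<open>
  A word is a bounded natural number or an input point (the dimension is constant, so a point
  takes a constant number of coordinates). Points are atomic: local computation may inspect their
  coordinates without restriction, but a machine can only keep or send a point that it already
  holds. Otherwise a single real number could encode the whole input, and the space bounds would
  say nothing.
\<close>

datatype 'p word = Num nat | Pt 'p

definition points :: "'p word set \<Rightarrow> 'p set" where
  "points A = {p. Pt p \<in> A}"

text \<open>
  The view of a machine at the beginning of a round: the words it kept, and the words it received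
  in the previous round, tagged with their senders.
\<close>

type_synonym 'p view = "'p word list \<times> (nat \<times> 'p word) list"

definition view_words :: "'p view \<Rightarrow> 'p word set" where
  "view_words v = set (fst v) \<union> snd ` set (snd v)"

text \<open>
  Given the round, the index of the machine and its view, a program yields the distribution of
  the words to keep and of the words to send, the latter tagged with their destinations. Local
  computation is unrestricted and uses private, fresh randomness; random outcomes needed in later
  rounds have to be kept in memory.
\<close>

type_synonym 'p program =
  "nat \<Rightarrow> nat \<Rightarrow> 'p view \<Rightarrow> ('p word list \<times> (nat \<times> 'p word) list) pmf"

definition deliver ::
  "nat \<Rightarrow> (nat \<Rightarrow> 'p word list \<times> (nat \<times> 'p word) list) \<Rightarrow> nat \<Rightarrow> 'p view" where
  "deliver M out j =
     (fst (out j), [(i, w). i \<leftarrow> [0..<M], (k, w) \<leftarrow> snd (out i), k = j])"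

primrec run :: "nat \<Rightarrow> 'p program \<Rightarrow> (nat \<Rightarrow> 'p word list) \<Rightarrow> nat \<Rightarrow> (nat \<Rightarrow> 'p view) pmf" where
  "run M prog inp 0 = return_pmf (\<lambda>i. (inp i, []))"
| "run M prog inp (Suc t) =
     bind_pmf (run M prog inp t)
       (\<lambda>c. map_pmf (deliver M) (Pi_pmf {..<M} ([], []) (\<lambda>i. prog t i (c i))))"

text \<open>
  The input points are distributed arbitrarily (each one held once) over \<open>M\<close> machines with
  \<open>S\<close> words of memory.
\<close>

definition input_on :: "nat \<Rightarrow> nat \<Rightarrow> 'p set \<Rightarrow> (nat \<Rightarrow> 'p word list) \<Rightarrow> bool" where
  "input_on M S P inp \<longleftrightarrow>
     (\<forall>i<M. length (inp i) \<le> S) \<and>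
     mset (concat (map inp [0..<M])) = image_mset Pt (mset_set P)"

text \<open>
  Numbers are below \<open>(S * M) ^ b\<close>, that is, words of \<open>O(log (S * M))\<close> bits.
\<close>

fun word_ok :: "nat \<Rightarrow> 'p set \<Rightarrow> 'p word \<Rightarrow> bool" where
  "word_ok W H (Num k) \<longleftrightarrow> k < W"
| "word_ok W H (Pt p) \<longleftrightarrow> p \<in> H"

text \<open>
  The limits of the model hold in every execution of \<open>R\<close> rounds, not just with high
  probability. The kept and the received words together have to fit into the local memory.
\<close>

definition respects_MPC ::
  "nat \<Rightarrow> nat \<Rightarrow> nat \<Rightarrow> 'p program \<Rightarrow> (nat \<Rightarrow> 'p word list) \<Rightarrow> nat \<Rightarrow> bool" where
  "respects_MPC M S b prog inp R \<longleftrightarrow>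
     (\<forall>t\<le>R. \<forall>c\<in>set_pmf (run M prog inp t). \<forall>i<M.
        length (fst (c i)) + length (snd (c i)) \<le> S) \<and>
     (\<forall>t<R. \<forall>c\<in>set_pmf (run M prog inp t). \<forall>i<M. \<forall>(mem, out)\<in>set_pmf (prog t i (c i)).
        length out \<le> S \<and> (\<forall>(k, w)\<in>set out. k < M) \<and>
        (\<forall>w \<in> set mem \<union> snd ` set out. word_ok ((S * M) ^ b) (points (view_words (c i))) w))"

text \<open>The output consists of the points kept in the memories of the machines at the end.\<close>

definition output_points :: "nat \<Rightarrow> (nat \<Rightarrow> 'p view) \<Rightarrow> 'p set" where
  "output_points M c = (\<Union>i<M. points (set (fst (c i))))"

end

theory Submission imports Defs begin

text \<open>
  In fixed dimension the bound can be met deterministically and in constantly many rounds: a subset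
  \<open>T\<close> of \<open>P\<close> whose points are pairwise more than \<open>2 r\<close> apart meets every cluster of radius at
  most \<open>r\<close> at most once, so \<open>|T| \<le> |\<C>|\<close>, and it remains to find such a \<open>T\<close> that covers \<open>P\<close>
  within \<open>O(r)\<close>.

  Round the points to a grid whose cells have diameter at most \<open>r\<close>. If the points are sorted by some
  key, each point can compare itself with its predecessor and drop out if both have the same key and
  are within \<open>2 r\<close>. With the cell as key this leaves one point per cell. Two cells of surviving points
  within \<open>2 r\<close> of each other differ by one of constantly many vectors \<open>v\<close>; for each \<open>v\<close> and each
  residue class \<open>\<rho>\<close> of cells modulo a constant, one more pass uses a key that merges each cell
  \<open>z \<in> \<rho>\<close> with \<open>z + v\<close>, so that every close pair meets in some pass. A pass moves the covering radius
  by at most \<open>2 r\<close>.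

  Sorting in constantly many rounds is Leighton's columnsort, applied recursively: with \<open>s\<^sup>D \<ge> n\<close>
  machines holding \<open>2 s\<^sup>2\<close> points each, every level of the recursion multiplies the length of the
  sorted blocks by \<open>s\<close>. The network is oblivious, so no machine is ever overloaded.
\<close>

section \<open>Sorting by wide comparators\<close>

text \<open>Sorts every aligned block of length \<open>B\<close> of an infinite sequence at once, so
  a layer of comparators is a function on sequences and no total length has to be carried
  along.\<close>

definition bsort :: "nat \<Rightarrow> (nat \<Rightarrow> 'k::linorder) \<Rightarrow> nat \<Rightarrow> 'k" where
  "bsort B a x = sort (map a [x div B * B ..< x div B * B + B]) ! (x mod B)"

lemma div_eq_iff_block:
  fixes r :: nat
  assumes "0 < r"
  shows "y div r = c \<longleftrightarrow> c * r \<le> y \<and> y < c * r + r"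
  using dividend_less_div_times[OF assms, of y]
  by (auto simp: div_nat_eqI add.commute mult.commute)

lemma bsort_block:
  assumes "0 < B"
  shows "map (bsort B a) [j * B ..< j * B + B] = sort (map a [j * B ..< j * B + B])"
proof (rule nth_equalityI)
  fix i assume i: "i < length (map (bsort B a) [j * B ..< j * B + B])"
  then have "i < B" by simp
  then show "map (bsort B a) [j * B ..< j * B + B] ! i = sort (map a [j * B ..< j * B + B]) ! i"
    using assms by (simp add: bsort_def)
qed simp

lemma bsort_mono:
  assumes "0 < B" "x \<le> y" "x div B = y div B"
  shows "bsort B a x \<le> bsort B a y"
proof -
  have "x mod B \<le> y mod B"
    using assms by (metis add_le_cancel_left div_mult_mod_eq)
  then show ?thesis
    using assms unfolding bsort_def by (auto intro!: sorted_nth_mono)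
qed

lemma bsort_id:
  assumes "0 < B" "\<And>y z. y div B = x div B \<Longrightarrow> z div B = x div B \<Longrightarrow> y \<le> z \<Longrightarrow> a y \<le> a z"
  shows "bsort B a x = a x"
proof -
  have "sorted (map a [x div B * B ..< x div B * B + B])"
    using assms by (auto simp: sorted_iff_nth_mono div_eq_iff_block)
  then have "sort (map a [x div B * B ..< x div B * B + B]) = map a [x div B * B ..< x div B * B + B]"
    by (rule sorted_sort_id)
  then have "bsort B a x = map a [x div B * B ..< x div B * B + B] ! (x mod B)"
    by (simp only: bsort_def)
  also have "\<dots> = a ([x div B * B ..< x div B * B + B] ! (x mod B))"
    using mod_less_divisor[OF assms(1), of x] by (intro nth_map) simp
  also have "[x div B * B ..< x div B * B + B] ! (x mod B) = x div B * B + x mod B"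
    using mod_less_divisor[OF assms(1), of x] by (intro nth_upt) linarith
  finally show ?thesis by simp
qed

lemma map_sort_mono:
  assumes "mono f"
  shows "map f (sort xs) = sort (map f xs)"
proof (rule sym, rule properties_for_sort)
  show "sorted (map f (sort xs))"
    unfolding sorted_iff_nth_mono
  proof (intro allI impI)
    fix i j assume "i \<le> j" "j < length (map f (sort xs))"
    then have "sort xs ! i \<le> sort xs ! j" by (simp add: sorted_nth_mono)
    then show "map f (sort xs) ! i \<le> map f (sort xs) ! j"
      using assms \<open>i \<le> j\<close> \<open>j < length (map f (sort xs))\<close> by (simp add: monoD)
  qed
qed simp

text \<open>The source of the zero-one principle: a monotone threshold turns keys into booleans and
  may be applied before or after a layer of comparators.\<close>

lemma bsort_comp_mono:
  assumes "mono f" "0 < B"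
  shows "f \<circ> bsort B a = bsort B (f \<circ> a)"
proof
  fix x
  have "sort (map (f \<circ> a) [x div B * B..<x div B * B + B])
     = map f (sort (map a [x div B * B..<x div B * B + B]))"
    using assms by (simp add: map_sort_mono)
  then show "(f \<circ> bsort B a) x = bsort B (f \<circ> a) x"
    using assms by (simp add: bsort_def)
qed

lemma bsort_mset:
  assumes "0 < B"
  shows "mset (map (bsort B a) [0..<B * m]) = mset (map a [0..<B * m])"
proof (induction m)
  case (Suc m)
  have "[0..<B * Suc m] = [0..<B * m] @ [m * B..<m * B + B]"
    by (metis add.commute le0 mult.commute mult_Suc upt_add_eq_append)
  then show ?case using Suc bsort_block[OF assms, of a m] by simp
qed simp

lemma bsort_shift:
  assumes "0 < B" "B dvd N"
  shows "bsort B a (J * N + y) = bsort B (\<lambda>y. a (J * N + y)) y"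
proof -
  obtain q where q: "N = B * q" using assms by auto
  have "(J * N + y) div B = J * q + y div B"
    using assms(1) unfolding q by (metis div_mult_self3 less_not_refl mult.commute mult.left_commute)
  moreover have "(J * N + y) mod B = y mod B" 
    unfolding q by (simp add: mult.left_commute)
  moreover have "map a [(J * q + y div B) * B..<(J * q + y div B) * B + B]
     = map (\<lambda>y. a (J * N + y)) [y div B * B..<y div B * B + B]"
    by (rule nth_equalityI) (auto simp: q algebra_simps)
  ultimately show ?thesis by (simp add: bsort_def)
qed

lemma sort_bool: "sort xs = replicate (length (filter Not xs)) False @ replicate (length (filter id xs)) True"
proof (rule properties_for_sort)
  show "mset (replicate (length (filter Not xs)) False @ replicate (length (filter id xs)) True) = mset xs"
    by (induction xs) auto
qed (auto simp: sorted_append)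

text \<open>A sorted boolean block starts with its \<open>False\<close> entries, so an entry is
  decided by comparing its offset with their number. From here on sorting is counting.\<close>

lemma bsort_bool:
  assumes "0 < B"
  shows "bsort B a x \<longleftrightarrow> card {i. i < B \<and> \<not> a (x div B * B + i)} \<le> x mod B"
proof -
  let ?xs = "map a [x div B * B ..< x div B * B + B]"
  have "length (filter Not ?xs) = card {i. i < B \<and> \<not> a (x div B * B + i)}"
    unfolding length_filter_conv_card by (rule arg_cong[of _ _ card]) auto
  moreover have "length (filter Not ?xs) + length (filter id ?xs) = B"
    using sum_length_filter_compl[of id ?xs] by simp
  ultimately show ?thesis
    using assms mod_less_divisor[OF assms, of x]
    unfolding bsort_def sort_bool by (auto simp: nth_append)
qed

text \<open>Sorted rearrangements are unique, so a network is identified by permuting its input and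
  having monotone output.\<close>

lemma bsort_eqI:
  assumes "mset (map b [0..<N]) = mset (map a [0..<N])" "y < N"
    "\<And>y z. y \<le> z \<Longrightarrow> z < N \<Longrightarrow> b y \<le> b z"
  shows "bsort N a y = b y"
proof -
  have "sort (map a [0..<N]) = map b [0..<N]"
    using assms by (intro properties_for_sort) (auto simp: sorted_iff_nth_mono)
  then show ?thesis using assms by (simp add: bsort_def)
qed

lemma mset_map_perm:
  assumes "bij_betw p {..<N} {..<N::nat}"
  shows "mset (map (a \<circ> p) [0..<N]) = mset (map a [0..<N])"
proof -
  have "mset (map (a \<circ> p) [0..<N]) = image_mset a (image_mset p (mset_set {..<N}))"
    by (simp add: multiset.map_comp atLeast0LessThan comp_def)
  also have "image_mset p (mset_set {..<N}) = mset_set {..<N}"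
    using assms by (simp add: image_mset_mset_set bij_betw_def)
  finally show ?thesis by (simp only: mset_map mset_upt atLeast0LessThan)
qed

section \<open>Columnsort: routing permutations and correctness on booleans\<close>

definition on_blocks :: "nat \<Rightarrow> (nat \<Rightarrow> nat) \<Rightarrow> nat \<Rightarrow> nat" where
  "on_blocks N p x = x div N * N + p (x mod N)"

text \<open>Routings, like comparator layers, commute with shifts by whole blocks, so correctness
  has to be checked on block 0 only.\<close>

lemma on_blocks_shift:
  assumes "0 < N"
  shows "on_blocks N p (J * N + y) = J * N + on_blocks N p y"
  using assms by (simp add: on_blocks_def algebra_simps)

lemma on_blocks_less: "y < N \<Longrightarrow> on_blocks N p y = p y"
  by (simp add: on_blocks_def)

lemma on_blocks_inverse:
  assumes "0 < N" "\<And>y. y < N \<Longrightarrow> p y < N \<and> q (p y) = y"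
  shows "on_blocks N q (on_blocks N p x) = x"
  using assms(2)[of "x mod N"] assms(1) by (simp add: on_blocks_def)

lemma on_blocks_div:
  assumes "0 < N" "\<And>y. y < N \<Longrightarrow> p y < N" "N dvd K"
  shows "on_blocks N p x div K = x div K"
proof -
  obtain q where q: "K = N * q" using assms by auto
  have "on_blocks N p x div N = x div N"
    using assms by (simp add: on_blocks_def)
  then show ?thesis by (simp add: q div_mult2_eq)
qed

text \<open>Transposition of a matrix with \<open>r\<close> rows and \<open>s\<close> columns: the
  position \<open>i * s + j\<close> in row order goes to \<open>j * r + i\<close> in column order.
  The inverse is \<open>deal s r\<close>.\<close>

definition deal :: "nat \<Rightarrow> nat \<Rightarrow> nat \<Rightarrow> nat" where
  "deal r s y = (y mod s) * r + y div s"

text \<open>Moves the borders between blocks of length \<open>r\<close> into the middle of blocks.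
  The first and the last half block of \<open>{..<N}\<close>, which have no partner, are joined in
  block 0.\<close>

definition halfshift :: "nat \<Rightarrow> nat \<Rightarrow> nat \<Rightarrow> nat" where
  "halfshift r N y = (if y < r div 2 then y else if N - r div 2 \<le> y then y + r - N else y + r div 2)"

definition halfunshift :: "nat \<Rightarrow> nat \<Rightarrow> nat \<Rightarrow> nat" where
  "halfunshift r N y = (if y < r div 2 then y else if y < r then y + N - r else y - r div 2)"

lemma deal_less:
  assumes "y < r * s"
  shows "deal r s y < r * s"
proof -
  have s: "0 < s" using assms by (cases s) auto
  have "y div s < r" using assms by (simp add: less_mult_imp_div_less)
  moreover have "Suc (y mod s) \<le> s" using s by (simp add: Suc_leI)
  then have "Suc (y mod s) * r \<le> s * r" by (rule mult_le_mono1)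
  ultimately show ?thesis by (simp add: deal_def mult.commute)
qed

lemma deal_deal:
  assumes "y < r * s"
  shows "deal s r (deal r s y) = y"
proof -
  have "y div s < r" using assms by (simp add: less_mult_imp_div_less)
  then show ?thesis by (simp add: deal_def)
qed

lemma halfshift_inverse:
  assumes "even r" "r \<le> N" "y < N"
  shows "halfshift r N y < N" "halfunshift r N (halfshift r N y) = y"
    "halfunshift r N y < N" "halfshift r N (halfunshift r N y) = y"
proof -
  obtain h where h: "r = h + h" using assms(1) by (metis evenE mult_2)
  have h2: "r div 2 = h" using h by simp
  show "halfshift r N y < N" "halfunshift r N (halfshift r N y) = y"
    using assms h unfolding halfshift_def halfunshift_def h2 by auto
  show "halfunshift r N y < N" "halfshift r N (halfunshift r N y) = y"
    using assms h unfolding halfshift_def halfunshift_def h2 by auto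
qed

lemma bij_betw_inverse:
  assumes "\<And>y. y < N \<Longrightarrow> p y < N \<and> q (p y) = y" "\<And>y. y < N \<Longrightarrow> q y < N \<and> p (q y) = y"
  shows "bij_betw p {..<N} {..<N::nat}"
  using assms by (intro bij_betwI[where g = q]) (simp_all add: Pi_iff)

text \<open>The second sweep sorts the blocks displaced by half a block; the leftover halves at both ends
  form one block, which the first sweep has already put into order.\<close>

lemma clean_window:
  fixes a :: "nat \<Rightarrow> bool"
  assumes r: "0 < r" "even r" "2 * h \<le> r" and N: "N = r * s" "0 < s"
    and lo: "\<And>y. y < N \<Longrightarrow> y < lo \<Longrightarrow> \<not> a y" and hi: "\<And>y. y < N \<Longrightarrow> lo + h \<le> y \<Longrightarrow> a y"
    and yz: "y \<le> z" "z < N"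
  defines "b \<equiv> bsort r a"
  defines "e \<equiv> bsort r (b \<circ> on_blocks N (halfunshift r N)) \<circ> on_blocks N (halfshift r N)"
  shows "e y \<le> e z"
proof -
  define h' where "h' = r div 2"
  have h': "r = 2 * h'" "h \<le> h'" "0 < h'" using r by (auto simp: h'_def)
  have rN: "r \<le> N" using N by simp
  have blk: "x div r * r + r \<le> N" if "x < N" for x
  proof -
    have "x div r < s" using that N by (simp add: less_mult_imp_div_less mult.commute)
    then have "Suc (x div r) * r \<le> s * r" by (intro mult_le_mono1) simp
    then show ?thesis by (simp add: N mult.commute)
  qed
  have inblk: "w < N" if "x < N" "w div r = x div r" for x w
  proof -
    have "w < w div r * r + r" using r(1) by (metis add.commute dividend_less_div_times mult.commute)
    then show ?thesis using blk[OF that(1)] that(2) by simp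
  qed
  \<comment> \<open>The first sweep keeps both ends clean: in the block of \<open>x\<close>, the
    \<open>x mod r + 1\<close> entries up to \<open>x\<close> are already \<open>False\<close>, so
    sorting puts a \<open>False\<close> at \<open>x\<close>. Dually for \<open>bhi\<close>.\<close>
  have blo: "\<not> b x" if "x < N" "x < lo" for x
  proof -
    have "\<not> a (x div r * r + i)" if "i \<le> x mod r" for i
    proof -
      have "x div r * r + i \<le> x" using that by (metis add_le_cancel_left div_mult_mod_eq)
      then show ?thesis using lo \<open>x < N\<close> \<open>x < lo\<close> by simp
    qed
    then have "{..x mod r} \<subseteq> {i. i < r \<and> \<not> a (x div r * r + i)}"
      using mod_less_divisor[OF r(1), of x] by fastforce
    then have "card {..x mod r} \<le> card {i. i < r \<and> \<not> a (x div r * r + i)}" by (intro card_mono) auto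
    then show ?thesis using r by (simp add: b_def bsort_bool)
  qed
  have bhi: "b x" if "x < N" "lo + h \<le> x" for x
  proof -
    have "a (x div r * r + i)" if "i < r" "x mod r \<le> i" for i
    proof -
      have "x \<le> x div r * r + i" using that(2) by (metis add_le_cancel_left div_mult_mod_eq)
      moreover have "x div r * r + i < N" using blk[OF \<open>x < N\<close>] that(1) by simp
      ultimately show ?thesis using hi \<open>lo + h \<le> x\<close> by simp
    qed
    then have "{i. i < r \<and> \<not> a (x div r * r + i)} \<subseteq> {..<x mod r}" by (auto simp: not_le[symmetric])
    then have "card {i. i < r \<and> \<not> a (x div r * r + i)} \<le> card {..<x mod r}" by (intro card_mono) auto
    then show ?thesis using r by (simp add: b_def bsort_bool)
  qed
  define u where "u = b \<circ> on_blocks N (halfunshift r N)"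
  have hs: "halfshift r N x < N" "halfunshift r N (halfshift r N x) = x" if "x < N" for x
    using halfshift_inverse[OF r(2) rN that] by auto
  have e: "e x = bsort r u (halfshift r N x)" if "x < N" for x
    using that by (simp add: e_def u_def on_blocks_less)
  have u: "u x = b (halfunshift r N x)" if "x < N" for x
    using that by (simp add: u_def on_blocks_less)
  show ?thesis
  \<comment> \<open>Either an interior border \<open>c * r\<close> lies strictly inside the window,
    and then \<open>h \<le> h'\<close> keeps the window within half a block of it, or no border does
    and the first sweep has sorted everything.\<close>
  proof (cases "\<exists>c>0. c < s \<and> c * r - h' \<le> lo \<and> lo + h \<le> c * r + h' \<and> lo < c * r \<and> c * r < lo + h")
    case True
    then obtain c where c: "0 < c" "c < s" "c * r - h' \<le> lo" "lo + h \<le> c * r + h'" by auto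
    have cr: "r \<le> c * r" using c by simp
    have crN: "c * r + r \<le> N" using mult_le_mono1[of "Suc c" s r] c by (simp add: N mult.commute)
    \<comment> \<open>Away from the shifted block \<open>c\<close> the second sweep changes nothing:
      those blocks are already sorted, block 0 because it consists of zeros followed by
      ones.\<close>
    have out: "e x = b x" if x: "x < N" "x < c * r - h' \<or> c * r + h' \<le> x" for x
    proof -
      have ne: "halfshift r N x div r \<noteq> c"
      proof
        assume "halfshift r N x div r = c"
        then have *: "c * r \<le> halfshift r N x" "halfshift r N x < c * r + r"
          using r(1) by (auto simp: div_eq_iff_block)
        consider "halfshift r N x = x" "x < h'" | "halfshift r N x = x + r - N" "N - h' \<le> x"
          | "halfshift r N x = x + h'"
          by (cases "x < h'"; cases "N - h' \<le> x"; simp add: halfshift_def h'_def[symmetric])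
        then show False using x * cr crN h' rN by cases linarith+
      qed
      have "bsort r u (halfshift r N x) = u (halfshift r N x)"
      proof (rule bsort_id[OF r(1)])
        fix v w assume v: "v div r = halfshift r N x div r" and w: "w div r = halfshift r N x div r"
          and vw: "v \<le> w"
        have vN: "v < N" "w < N" using v w inblk hs(1)[OF x(1)] by auto
        have nv: "v < c * r \<or> c * r + r \<le> v" "w < c * r \<or> c * r + r \<le> w" 
          using ne v w r(1) by (metis div_eq_iff_block not_le)+
        have vr: "w < r" if "v < r"
        proof -
          have "w div r = 0" using that v w by simp
          then show ?thesis using r(1) by (simp add: div_eq_0_iff)
        qed
        have vc: "c * r + r \<le> v" if "c * r + r \<le> w"
        proof (rule ccontr)
          assume "\<not> c * r + r \<le> v"
          then have "v < Suc c * r" by simp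
          then have "v div r < Suc c" using r(1) by (simp add: div_less_iff_less_mult)
          moreover have "Suc c * r \<le> w" using that by simp
          then have "Suc c \<le> w div r" using r(1) by (simp add: less_eq_div_iff_mult_less_eq)
          ultimately show False using v w by simp
        qed
        consider "w < r" | "r \<le> v" "w < c * r" | "c * r + r \<le> v" "r \<le> v"
          using nv vr vc cr by linarith
        then show "u v \<le> u w"
        proof cases
          case 1
          show ?thesis
          proof (cases "w < h'")
            case True
            then have "v < lo" using vw c cr h' by linarith
            then have "\<not> b v" using blo vN by blast
            moreover have "halfunshift r N v = v" using True vw by (simp add: halfunshift_def h'_def)
            ultimately show ?thesis using u[OF vN(1)] by simp
          next
            case False
            then have "halfunshift r N w = w + N - r" using 1 by (simp add: halfunshift_def h'_def)
            moreover have "lo + h \<le> w + N - r" "w + N - r < N"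
              using False c crN h' 1 vN rN by linarith+
            ultimately have "u w" using u[OF vN(2)] bhi by simp
            then show ?thesis by simp
          qed
        next
          case 2
          then have "halfunshift r N v = v - h'" using h' by (simp add: halfunshift_def)
          moreover have "v - h' < lo" "v - h' < N" using 2 vw vN c h' by linarith+
          ultimately have "\<not> u v" using u[OF vN(1)] blo by simp
          then show ?thesis by simp
        next
          case 3
          then have "\<not> w < r div 2" "\<not> w < r" using vw h' by linarith+
          then have "halfunshift r N w = w - h'" using h' by (simp add: halfunshift_def)
          moreover have "lo + h \<le> w - h'" "w - h' < N" using 3 vw vN c h' by linarith+
          ultimately have "u w" using u[OF vN(2)] bhi by simp
          then show ?thesis by simp
        qed
      qed
      then show ?thesis using e[OF x(1)] u[OF hs(1)[OF x(1)]] hs(2)[OF x(1)] by simp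
    qed
    show ?thesis
    proof (cases "y < c * r - h' \<or> c * r + h' \<le> z")
      case True
      then show ?thesis
      proof
        assume "y < c * r - h'"
        then show ?thesis using out[of y] blo[of y] c yz by auto
      next
        assume "c * r + h' \<le> z"
        then show ?thesis using out[of z] bhi[of z] c yz by auto
      qed
    next
      case False
      \<comment> \<open>The half blocks on both sides of the border make up exactly the shifted
        block \<open>c\<close>, which the second sweep sorts.\<close>
      have "halfshift r N x = x + h'" "(x + h') div r = c" if "c * r - h' \<le> x" "x < c * r + h'" for x
      proof -
        have "\<not> x < h'" "\<not> N - h' \<le> x" using that cr crN h' by linarith+
        then show "halfshift r N x = x + h'" by (simp add: halfshift_def h'_def)
        show "(x + h') div r = c" unfolding div_eq_iff_block[OF r(1)] using that h' by linarith
      qed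
      note hx = this
      have "y < N" "c * r - h' \<le> y" "z < c * r + h'" using False yz by auto
      then have "e y = bsort r u (y + h')" "e z = bsort r u (z + h')"
        "(y + h') div r = c" "(z + h') div r = c"
        using hx[of y] hx[of z] yz by (simp_all add: e)
      then show ?thesis using bsort_mono[OF r(1), of "y + h'" "z + h'" u] yz by simp
    qed
  next
    case False
    \<comment> \<open>Two entries in wrong order would lie in the window and in different blocks;
      the left end of the block of \<open>w\<close> would then be a border inside the
      window.\<close>
    have bm: "b v \<le> b w" if vw: "v \<le> w" "w < N" for v w
    proof (cases "v div r = w div r")
      case True
      then show ?thesis using bsort_mono[OF r(1) vw(1), of a] by (simp add: b_def)
    next
      case ne: False
      show ?thesis
      proof (rule ccontr)
        assume "\<not> b v \<le> b w"
        then have bb: "b v" "\<not> b w" by auto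
        then have *: "lo \<le> v" "w < lo + h" using blo[of v] bhi[of w] vw by (auto simp: not_le[symmetric])
        define c where "c = w div r"
        have "v div r < c" using ne vw div_le_mono[of v w r] by (simp add: c_def)
        then have "v < c * r" using r(1) by (simp add: div_less_iff_less_mult)
        moreover have "c * r \<le> w" by (simp add: c_def)
        moreover have "c < s" using vw N by (simp add: c_def less_mult_imp_div_less mult.commute)
        moreover have "0 < c" using \<open>v div r < c\<close> by simp
        moreover have "c * r - h' \<le> lo" "lo + h \<le> c * r + h'" "lo < c * r" "c * r < lo + h"
          using calculation * h' by linarith+
        ultimately show False using False by blast
      qed
    qed
    have "e x = b x" if x: "x < N" for x
    proof -
      have "bsort r u (halfshift r N x) = u (halfshift r N x)"
      proof (rule bsort_id[OF r(1)])
        fix v w assume v: "v div r = halfshift r N x div r" and w: "w div r = halfshift r N x div r"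
          and vw: "v \<le> w"
        have vN: "v < N" "w < N" using v w inblk hs(1)[OF x(1)] by auto
        have vr: "w < r" if "v < r"
        proof -
          have "w div r = 0" using that v w by simp
          then show ?thesis using r(1) by (simp add: div_eq_0_iff)
        qed
        \<comment> \<open>\<open>halfunshift\<close> is monotone on each shifted block, block 0
          included, so \<open>u\<close> inherits the order of \<open>b\<close> there.\<close>
        have "halfunshift r N v \<le> halfunshift r N w"
        proof (cases "w < r")
          case True
          then show ?thesis using vw rN unfolding halfunshift_def by (simp; linarith)
        next
          case False
          then have "halfunshift r N w = w - h'" using h' by (simp add: halfunshift_def)
          moreover have "halfunshift r N v = v \<and> v < h' \<or> halfunshift r N v = v - h'"
            using False vr by (auto simp: halfunshift_def h'_def)
          ultimately show ?thesis using False vw h' by linarith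
        qed
        then show "u v \<le> u w"
          using bm halfshift_inverse(3)[OF r(2) rN vN(2)] vN by (simp add: u)
      qed
      then show ?thesis using e[OF x(1)] u[OF hs(1)[OF x(1)]] hs(2)[OF x(1)] by simp
    qed
    then show ?thesis using bm yz by simp
  qed
qed

text \<open>Each sorted column contributes almost equally many zeros to all new columns, so after dealing the
  columns differ by at most one zero per old column. Reading the sorted columns row by row leaves at most
  \<open>s\<close> mixed rows of length \<open>s\<close>.\<close>

lemma columnsort_window:
  fixes a :: "nat \<Rightarrow> bool"
  assumes r: "0 < r" and s: "0 < s" "s dvd r" and N: "N = r * s"
  defines "e \<equiv> bsort r (bsort r a \<circ> on_blocks N (deal s r)) \<circ> on_blocks N (deal r s)"
  shows "\<exists>lo. \<forall>y<N. (y < lo \<longrightarrow> \<not> e y) \<and> (lo + s * s \<le> y \<longrightarrow> e y)"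
proof -
  define b where "b = bsort r a"
  \<comment> \<open>The rows with a zero in column \<open>j\<close> after dealing.\<close>
  define Z where "Z j = {i. i < r \<and> \<not> b (i * s + j)}" for j
  have fin: "finite (Z j)" for j by (simp add: Z_def)
  have e: "e y \<longleftrightarrow> card (Z (y mod s)) \<le> y div s" if y: "y < N" for y
  proof -
    let ?x = "deal r s y"
    have "?x < N" using y deal_less N by simp
    have yr: "y div s < r" using y by (simp add: N less_mult_imp_div_less)
    have xd: "?x div r = y mod s" "?x mod r = y div s" using yr r by (simp_all add: deal_def)
    have "b (on_blocks N (deal s r) (?x div r * r + i)) = b (i * s + y mod s)" if "i < r" for i
    proof -
      have "y mod s * r + i < N"
        using mult_le_mono1[of "Suc (y mod s)" s r] s that by (simp add: N mult.commute Suc_leI)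
      then have "on_blocks N (deal s r) (y mod s * r + i) = deal s r (y mod s * r + i)"
        by (rule on_blocks_less)
      also have "\<dots> = i * s + y mod s" using that by (simp add: deal_def)
      finally show ?thesis unfolding xd by (rule arg_cong)
    qed
    then have "{i. i < r \<and> \<not> (b \<circ> on_blocks N (deal s r)) (?x div r * r + i)} = Z (y mod s)"
      by (auto simp: Z_def)
    then show ?thesis using y r by (simp add: e_def b_def[symmetric] on_blocks_less bsort_bool xd)
  qed
  obtain k where k: "r = s * k" using s by auto
  \<comment> \<open>As \<open>s\<close> divides \<open>r\<close>, the \<open>s\<close> consecutive
    positions of row \<open>i\<close> lie in a single sorted old column, the one with index
    \<open>i div k\<close>. Hence every row is sorted and \<open>Z\<close> is decreasing.\<close>
  have row: "(i * s + j) div r = i div k" if "j < s" for i j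
    using that unfolding k by (simp add: div_mult2_eq)
  have mono_row: "b (i * s + j) \<longrightarrow> b (i * s + j')" if "j \<le> j'" "j' < s" for i j j'
    using that row[of j i] row[of j' i] bsort_mono[OF r, of "i * s + j" "i * s + j'" a] by (simp add: b_def)
  have Zmono: "Z j' \<subseteq> Z j" if "j \<le> j'" "j' < s" for j j'
    using mono_row[OF that] by (auto simp: Z_def)
  \<comment> \<open>\<open>Z 0 - Z (s - 1)\<close> are the mixed rows, which begin with
    \<open>False\<close> and end with \<open>True\<close>. Two of them inside one old column would
    contradict its order, so each of the \<open>s\<close> old columns has at most one.\<close>
  have "inj_on (\<lambda>i. i div k) (Z 0 - Z (s - 1))"
  proof (rule linorder_inj_onI')
    fix i i' assume i: "i \<in> Z 0 - Z (s - 1)" and i': "i' \<in> Z 0 - Z (s - 1)" and "i < i'"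
    show "i div k \<noteq> i' div k"
    proof
      assume "i div k = i' div k"
      then have "(i * s + (s - 1)) div r = (i' * s + 0) div r"
        using row[of "s - 1" i] row[of 0 i'] s by (metis diff_less zero_less_one)
      moreover have "i * s + (s - 1) \<le> i' * s + 0"
        using mult_le_mono1[of "Suc i" i' s] \<open>i < i'\<close> by simp
      ultimately have "b (i * s + (s - 1)) \<le> b (i' * s + 0)"
        unfolding b_def by (intro bsort_mono r)
      then show False using i i' by (auto simp: Z_def)
    qed
  qed
  moreover have "(\<lambda>i. i div k) ` (Z 0 - Z (s - 1)) \<subseteq> {..<s}"
    using k by (auto simp: Z_def less_mult_imp_div_less)
  ultimately have "card (Z 0 - Z (s - 1)) \<le> s"
    using card_inj_on_le[of _ _ "{..<s}"] by fastforce
  then have "card (Z 0) \<le> card (Z (s - 1)) + s"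
    using card_Diff_subset[OF fin Zmono[of 0 "s - 1"]] s by simp
  moreover have "card (Z (s - 1)) \<le> card (Z j)" "card (Z j) \<le> card (Z 0)" if "j < s" for j
    using that by (simp_all add: card_mono[OF fin Zmono])
  ultimately have Zb: "card (Z (s - 1)) \<le> card (Z j)" "card (Z j) \<le> card (Z (s - 1)) + s" if "j < s" for j
    using that by fastforce+
  show ?thesis
  \<comment> \<open>Every column has at least \<open>card (Z (s - 1))\<close> zeros, so after
    undealing that many rows are entirely zero; \<open>s\<close> rows further on no zeros
    remain.\<close>
  proof (intro exI[of _ "card (Z (s - 1)) * s"] allI impI conjI)
    fix y assume y: "y < N"
    { assume "y < card (Z (s - 1)) * s"
      then have "y div s < card (Z (s - 1))" using s by (simp add: div_less_iff_less_mult)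
      then show "\<not> e y" using e[OF y] Zb[of "y mod s"] s by auto }
    { assume "card (Z (s - 1)) * s + s * s \<le> y"
      then have "card (Z (s - 1)) + s \<le> y div s"
        using s by (simp add: less_eq_div_iff_mult_less_eq add_mult_distrib)
      then show "e y" using e[OF y] Zb[of "y mod s"] s by (auto intro: order_trans) }
  qed
qed

lemma bsort_dvd_mset:
  assumes "0 < r" "r dvd N"
  shows "mset (map (bsort r a) [0..<N]) = mset (map a [0..<N])"
  using assms bsort_mset by (metis dvdE)

lemma mset_map_on_blocks:
  assumes "\<And>y. y < N \<Longrightarrow> p y < N \<and> q (p y) = y" "\<And>y. y < N \<Longrightarrow> q y < N \<and> p (q y) = y"
  shows "mset (map (a \<circ> on_blocks N p) [0..<N]) = mset (map a [0..<N])"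
proof -
  have "mset (map (a \<circ> on_blocks N p) [0..<N]) = mset (map (a \<circ> p) [0..<N])"
    by (rule arg_cong[of _ _ mset], rule map_cong) (auto simp: on_blocks_less)
  also have "\<dots> = mset (map a [0..<N])"
    using assms by (intro mset_map_perm bij_betw_inverse[where q = q]) blast+
  finally show ?thesis .
qed

text \<open>Sorting, dealing, sorting and undealing leave a window of length \<open>s * s\<close>;
  as \<open>2 * (s * s) \<le> r\<close>, the last two sweeps clean it. The result is a monotone
  rearrangement on \<open>{..<N}\<close>, and the other blocks follow by shifting.\<close>

lemma columnsort_bool:
  fixes a :: "nat \<Rightarrow> bool"
  assumes r: "0 < r" "even r" "2 * (s * s) \<le> r" and s: "0 < s" "s dvd r" and N: "N = r * s"
  shows "bsort r (bsort r (bsort r (bsort r a \<circ> on_blocks N (deal s r)) \<circ> on_blocks N (deal r s))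
      \<circ> on_blocks N (halfunshift r N)) \<circ> on_blocks N (halfshift r N) = bsort N a" (is "?F a = _")
proof -
  have rN: "r \<le> N" "r dvd N" "0 < N" using N s r by auto
  have d1: "deal s r y < N" "deal r s (deal s r y) = y"
    "deal r s y < N" "deal s r (deal r s y) = y" if "y < N" for y
    using that deal_less[of y r s] deal_less[of y s r] deal_deal[of y r s] deal_deal[of y s r]
    by (simp_all add: N mult.commute)
  have d2: "halfshift r N y < N" "halfunshift r N (halfshift r N y) = y"
    "halfunshift r N y < N" "halfshift r N (halfunshift r N y) = y" if "y < N" for y
    using halfshift_inverse[OF r(2) rN(1) that] by auto
  have m: "mset (map (a \<circ> on_blocks N (deal s r)) [0..<N]) = mset (map a [0..<N])"
    "mset (map (a \<circ> on_blocks N (deal r s)) [0..<N]) = mset (map a [0..<N])"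
    "mset (map (a \<circ> on_blocks N (halfshift r N)) [0..<N]) = mset (map a [0..<N])"
    "mset (map (a \<circ> on_blocks N (halfunshift r N)) [0..<N]) = mset (map a [0..<N])" for a :: "nat \<Rightarrow> bool"
  proof -
    show "mset (map (a \<circ> on_blocks N (deal s r)) [0..<N]) = mset (map a [0..<N])"
      by (rule mset_map_on_blocks[where q = "deal r s"]) (simp_all add: d1)
    show "mset (map (a \<circ> on_blocks N (deal r s)) [0..<N]) = mset (map a [0..<N])"
      by (rule mset_map_on_blocks[where q = "deal s r"]) (simp_all add: d1)
    show "mset (map (a \<circ> on_blocks N (halfshift r N)) [0..<N]) = mset (map a [0..<N])"
      by (rule mset_map_on_blocks[where q = "halfunshift r N"]) (simp_all add: d2)
    show "mset (map (a \<circ> on_blocks N (halfunshift r N)) [0..<N]) = mset (map a [0..<N])"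
      by (rule mset_map_on_blocks[where q = "halfshift r N"]) (simp_all add: d2)
  qed
  have main: "?F a y = bsort N a y" if y: "y < N" for a y
  proof (rule sym, rule bsort_eqI[OF _ y])
    show "mset (map (?F a) [0..<N]) = mset (map a [0..<N])"
      by (simp only: m bsort_dvd_mset[OF r(1) rN(2)])
  next
    fix v w assume "v \<le> w" "w < N"
    obtain lo where "\<forall>y<N. (y < lo \<longrightarrow> \<not> (bsort r (bsort r a \<circ> on_blocks N (deal s r)) \<circ> on_blocks N (deal r s)) y) 
      \<and> (lo + s * s \<le> y \<longrightarrow> (bsort r (bsort r a \<circ> on_blocks N (deal s r)) \<circ> on_blocks N (deal r s)) y)"
      using columnsort_window[OF r(1) s N] by blast
    then show "?F a v \<le> ?F a w"
      using \<open>v \<le> w\<close> \<open>w < N\<close> by (intro clean_window[OF r N s(1), where lo = lo]) blast+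
  qed
  show ?thesis
  proof
    fix x
    define J where "J = x div N"
    have x: "x = J * N + x mod N" by (simp add: J_def)
    define sh where "sh b y = b (J * N + y)" for b :: "nat \<Rightarrow> bool" and y
    have sh1: "sh (bsort r b) = bsort r (sh b)" for b
      unfolding sh_def[abs_def] by (rule ext, rule bsort_shift[OF r(1) rN(2)])
    have sh2: "sh (b \<circ> on_blocks N p) = sh b \<circ> on_blocks N p" for b p
      by (rule ext) (simp only: sh_def comp_apply on_blocks_shift[OF rN(3)])
    have "sh (?F a) = ?F (sh a)" by (simp only: sh1 sh2)
    then have "?F a (J * N + x mod N) = ?F (\<lambda>y. a (J * N + y)) (x mod N)"
      unfolding sh_def[abs_def] by (rule fun_cong)
    also have "\<dots> = bsort N (\<lambda>y. a (J * N + y)) (x mod N)"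
      by (rule main) (simp add: rN(3))
    also have "\<dots> = bsort N a (J * N + x mod N)"
      by (rule bsort_shift[symmetric]) (simp_all add: rN(3))
    finally show "?F a x = bsort N a x" by (simp only: x[symmetric])
  qed
qed

text \<open>A routing is a pair of a permutation of the positions and its inverse.\<close>

fun exec :: "nat \<Rightarrow> ((nat \<Rightarrow> nat) \<times> (nat \<Rightarrow> nat)) list \<Rightarrow> (nat \<Rightarrow> 'k::linorder) \<Rightarrow> nat \<Rightarrow> 'k" where
  "exec B [] a = bsort B a"
| "exec B ((f, g) # ps) a = exec B ps (bsort B a \<circ> g)"

text \<open>Columnsort with each column sort replaced by the network one level below; level
  \<open>l\<close> sorts blocks of length \<open>B * s ^ l\<close>. The last routing undoes the half
  shift.\<close>

fun net :: "nat \<Rightarrow> nat \<Rightarrow> nat \<Rightarrow> ((nat \<Rightarrow> nat) \<times> (nat \<Rightarrow> nat)) list" where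
  "net B s 0 = []"
| "net B s (Suc l) =
    (let r = B * s ^ l; N = r * s;
       d = on_blocks N (deal r s); d' = on_blocks N (deal s r);
       h = on_blocks N (halfshift r N); h' = on_blocks N (halfunshift r N)
     in net B s l @ (d, d') # net B s l @ (d', d) # net B s l @ (h, h') # net B s l @ [(h', h)])"

section \<open>Correctness of the recursive network by the zero-one principle\<close>

lemma exec_append: "exec B (ps @ (f, g) # qs) a = exec B qs (exec B ps a \<circ> g)"
  by (induction ps arbitrary: a) auto

lemma exec_comp_mono:
  assumes "mono u" "0 < B"
  shows "u \<circ> exec B ps a = exec B ps (u \<circ> a)"
proof (induction ps arbitrary: a)
  case (Cons p ps)
  obtain f g where p: "p = (f, g)" by fastforce
  have "u \<circ> (bsort B a \<circ> g) = bsort B (u \<circ> a) \<circ> g"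
    by (simp only: bsort_comp_mono[OF assms] flip: comp_assoc)
  then show ?case using Cons[of "bsort B a \<circ> g"] by (simp only: p exec.simps)
qed (simp add: bsort_comp_mono[OF assms])

text \<open>Absorbs the layer that \<open>exec\<close> adds after the last routing.\<close>

lemma bsort_bsort_dvd:
  assumes "0 < B" "B dvd N" "0 < N"
  shows "bsort B (bsort N a) = bsort N a"
proof
  fix x
  obtain q where q: "N = B * q" using assms by auto
  show "bsort B (bsort N a) x = bsort N a x"
    by (rule bsort_id[OF assms(1)], rule bsort_mono[OF assms(3)]) (auto simp: q div_mult2_eq)
qed

text \<open>At every level the column length is a multiple of \<open>2 * (s * s)\<close>, which
  supplies all that \<open>columnsort_bool\<close> demands of it.\<close>

lemma exec_net_bool:
  fixes a :: "nat \<Rightarrow> bool"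
  assumes "B = 2 * (s * s)" "0 < s"
  shows "exec B (net B s l) a = bsort (B * s ^ l) a"
proof (induction l arbitrary: a)
  case (Suc l)
  define r where "r = B * s ^ l"
  have r: "0 < r" "even r" "2 * (s * s) \<le> r" "s dvd r"
    using assms by (auto simp: r_def)
  define N where "N = r * s"
  have B: "0 < B" "B dvd N" "0 < N" using assms r by (auto simp: r_def N_def)
  have "net B s (Suc l) = net B s l @ (on_blocks N (deal r s), on_blocks N (deal s r)) #
    net B s l @ (on_blocks N (deal s r), on_blocks N (deal r s)) #
    net B s l @ (on_blocks N (halfshift r N), on_blocks N (halfunshift r N)) #
    net B s l @ [(on_blocks N (halfunshift r N), on_blocks N (halfshift r N))]"
    by (simp add: Let_def r_def N_def)
  then have "exec B (net B s (Suc l)) a = bsort B (bsort N a)"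
    by (simp only: exec_append exec.simps Suc r_def[symmetric] columnsort_bool[OF r(1-3) assms(2) r(4) N_def])
  also have "\<dots> = bsort (B * s ^ Suc l) a"
    by (simp add: bsort_bsort_dvd[OF B]) (simp add: N_def r_def mult_ac)
  finally show ?case .
qed simp

lemma exec_net_mono:
  fixes a :: "nat \<Rightarrow> 'k::linorder"
  assumes "B = 2 * (s * s)" "0 < s" "x \<le> y" "y < B * s ^ l"
  shows "exec B (net B s l) a x \<le> exec B (net B s l) a y"
proof -
  \<comment> \<open>The output value at \<open>x\<close> serves as threshold: the boolean image of
    the output is sorted and \<open>True\<close> at \<open>x\<close>, hence \<open>True\<close> at
    \<open>y\<close>.\<close>
  define u where "u k \<longleftrightarrow> exec B (net B s l) a x \<le> k" for k
  have u: "mono u" by (auto simp: mono_def u_def)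
  have "u \<circ> exec B (net B s l) a = bsort (B * s ^ l) (u \<circ> a)"
    using assms by (simp add: exec_comp_mono[OF u] exec_net_bool)
  then have "u (exec B (net B s l) a x) \<le> u (exec B (net B s l) a y)"
    using bsort_mono[of "B * s ^ l" x y "u \<circ> a"] assms by (simp add: fun_eq_iff)
  then show ?thesis by (simp add: u_def)
qed

text \<open>The third equation confines the routings to the machines in use: for
  \<open>M = s ^ l\<close> the positions below \<open>M * B\<close> stay below
  \<open>M * B\<close>.\<close>

lemma net_perm:
  assumes "B = 2 * (s * s)" "0 < s" "(f, g) \<in> set (net B s l)"
  shows "f (g x) = x" "g (f x) = x" "f x div (B * s ^ l) = x div (B * s ^ l)"
proof -
  have "f (g x) = x \<and> g (f x) = x \<and> f x div (B * s ^ l) = x div (B * s ^ l)"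
    using assms(3)
  proof (induction l)
    case (Suc l)
    define r where "r = B * s ^ l"
    define N where "N = r * s"
    have r: "0 < r" "even r" using assms by (auto simp: r_def)
    have N: "0 < N" "r \<le> N" using r assms by (auto simp: N_def)
    have B: "B * s ^ Suc l = N" by (simp add: N_def r_def)
    have dv: "N dvd B * s ^ Suc l" using B by simp
    have d1: "deal s r y < N \<and> deal r s (deal s r y) = y"
      "deal r s y < N \<and> deal s r (deal r s y) = y" if "y < N" for y
      using that deal_less[of y r s] deal_less[of y s r] deal_deal[of y r s] deal_deal[of y s r]
      by (simp_all add: N_def mult.commute)
    have d2: "halfshift r N y < N \<and> halfunshift r N (halfshift r N y) = y"
      "halfunshift r N y < N \<and> halfshift r N (halfunshift r N y) = y" if "y < N" for y
      using halfshift_inverse[OF r(2) N(2) that] by auto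
    consider "(f, g) \<in> set (net B s l)"
      | "(f, g) = (on_blocks N (deal r s), on_blocks N (deal s r))"
      | "(f, g) = (on_blocks N (deal s r), on_blocks N (deal r s))"
      | "(f, g) = (on_blocks N (halfshift r N), on_blocks N (halfunshift r N))"
      | "(f, g) = (on_blocks N (halfunshift r N), on_blocks N (halfshift r N))"
      using Suc.prems by (auto simp: Let_def r_def N_def)
    then show ?case
    proof cases
      case 1
      then have IH: "f (g x) = x \<and> g (f x) = x \<and> f x div r = x div r" using Suc.IH by (simp add: r_def)
      then show ?thesis unfolding B by (simp add: N_def div_mult2_eq)
    qed (use d1 d2 N in \<open>simp_all add: on_blocks_inverse on_blocks_div dv del: power_Suc\<close>)
  qed simp
  then show "f (g x) = x" "g (f x) = x" "f x div (B * s ^ l) = x div (B * s ^ l)" by auto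
qed

section \<open>Deterministic programs and sorting in the MPC model\<close>

type_synonym 'p step = "nat \<Rightarrow> 'p view \<Rightarrow> 'p word list \<times> (nat \<times> 'p word) list"

text \<open>The pair of empty lists outside \<open>{..<M}\<close> is the default value of
  \<open>Pi_pmf\<close> in \<open>run\<close>, so a deterministic round is a point mass at
  \<open>advance\<close>.\<close>

definition advance :: "nat \<Rightarrow> 'p step \<Rightarrow> (nat \<Rightarrow> 'p view) \<Rightarrow> nat \<Rightarrow> 'p view" where
  "advance M st c = deliver M (\<lambda>i. if i < M then st i (c i) else ([], []))"

definition prog_of :: "'p step list \<Rightarrow> 'p program" where
  "prog_of sts t i v = return_pmf ((sts ! t) i v)"

lemma run_prog_of:
  "t \<le> length sts \<Longrightarrow>
    run M (prog_of sts) inp t = return_pmf (fold (advance M) (take t sts) (\<lambda>i. (inp i, [])))"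
proof (induction t)
  case (Suc t)
  then show ?case
    by (simp add: take_Suc_conv_app_nth prog_of_def bind_return_pmf Pi_pmf_return_pmf advance_def)
qed simp

definition fits :: "nat \<Rightarrow> nat \<Rightarrow> (nat \<Rightarrow> 'p view) \<Rightarrow> bool" where
  "fits M S c \<longleftrightarrow> (\<forall>i<M. length (fst (c i)) + length (snd (c i)) \<le> S)"

text \<open>Only points in view are kept or sent and never a number, so the condition on words in
  \<open>respects_MPC\<close> becomes a subset relation, for every exponent
  \<open>b\<close>.\<close>

definition legal_step :: "nat \<Rightarrow> nat \<Rightarrow> 'p step \<Rightarrow> (nat \<Rightarrow> 'p view) \<Rightarrow> bool" where
  "legal_step M S st c \<longleftrightarrow> (\<forall>i<M.
     length (snd (st i (c i))) \<le> S \<and> (\<forall>k\<in>fst ` set (snd (st i (c i))). k < M) \<and>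
     set (fst (st i (c i))) \<union> snd ` set (snd (st i (c i))) \<subseteq> Pt ` points (view_words (c i)))"

primrec legal :: "nat \<Rightarrow> nat \<Rightarrow> (nat \<Rightarrow> 'p view) \<Rightarrow> 'p step list \<Rightarrow> bool" where
  "legal M S c [] \<longleftrightarrow> fits M S c"
| "legal M S c (st # sts) \<longleftrightarrow> fits M S c \<and> legal_step M S st c \<and> legal M S (advance M st c) sts"

lemma legal_append:
  "legal M S c xs \<Longrightarrow> legal M S (fold (advance M) xs c) ys \<Longrightarrow> legal M S c (xs @ ys)"
  by (induction xs arbitrary: c) auto

lemma legal_fits: "legal M S c sts \<Longrightarrow> t \<le> length sts \<Longrightarrow> fits M S (fold (advance M) (take t sts) c)"
  by (induction sts arbitrary: c t) (auto simp: take_Cons split: nat.split)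

lemma legal_legal_step:
  "legal M S c sts \<Longrightarrow> t < length sts \<Longrightarrow> legal_step M S (sts ! t) (fold (advance M) (take t sts) c)"
  by (induction sts arbitrary: c t) (auto simp: take_Cons nth_Cons split: nat.split)

lemma legal_respects_MPC:
  assumes "legal M S (\<lambda>i. (inp i, [])) sts"
  shows "respects_MPC M S b (prog_of sts) inp (length sts)"
  unfolding respects_MPC_def
proof (intro conjI allI impI ballI)
  fix t c i assume "t \<le> length sts" "c \<in> set_pmf (run M (prog_of sts) inp t)" "i < M"
  then show "length (fst (c i)) + length (snd (c i)) \<le> S"
    using legal_fits[OF assms] by (auto simp: run_prog_of fits_def)
next
  fix t c i x
  assume t: "t < length sts" "c \<in> set_pmf (run M (prog_of sts) inp t)" "i < M"
    and x: "x \<in> set_pmf (prog_of sts t i (c i))"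
  have c: "c = fold (advance M) (take t sts) (\<lambda>i. (inp i, []))" using t by (simp add: run_prog_of)
  have x: "x = (sts ! t) i (c i)" using x by (simp add: prog_of_def)
  have "legal_step M S (sts ! t) c" using legal_legal_step[OF assms t(1)] c by simp
  then have L: "length (snd x) \<le> S" "\<forall>k\<in>fst ` set (snd x). k < M"
    "set (fst x) \<union> snd ` set (snd x) \<subseteq> Pt ` points (view_words (c i))"
    using t(3) unfolding legal_step_def x by auto
  have w: "word_ok ((S * M) ^ b) (points (view_words (c i))) w"
    if "w \<in> set (fst x) \<union> snd ` set (snd x)" for w
    using that L(3) by auto
  show "case x of (mem, out) \<Rightarrow> length out \<le> S \<and> (\<forall>(k, w)\<in>set out. k < M) \<and>
        (\<forall>w\<in>set mem \<union> snd ` set out. word_ok ((S * M) ^ b) (points (view_words (c i))) w)"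
    using L(1,2) w by (cases x) auto
qed

section \<open>Configurations as lists of points\<close>

fun pts :: "'p word list \<Rightarrow> 'p list" where
  "pts [] = []"
| "pts (Pt p # ws) = p # pts ws"
| "pts (Num k # ws) = pts ws"

lemma pts_map_Pt [simp]: "pts (map Pt xs) = xs"
  by (induction xs) auto

definition words :: "'p view \<Rightarrow> 'p word list" where
  "words v = fst v @ map snd (snd v)"

lemma set_words: "set (words v) = view_words v"
  by (simp add: words_def view_words_def)

text \<open>Does not distinguish points that were kept from points that have just arrived.\<close>

definition holds :: "nat \<Rightarrow> (nat \<Rightarrow> 'p view) \<Rightarrow> (nat \<Rightarrow> 'p list) \<Rightarrow> bool" where
  "holds M c L \<longleftrightarrow> (\<forall>i<M. words (c i) = map Pt (L i))"

lemma holds_fits: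
  assumes "holds M c L" "\<And>i. i < M \<Longrightarrow> length (L i) \<le> S"
  shows "fits M S c"
  unfolding fits_def
proof (intro allI impI)
  fix i assume "i < M"
  then have "length (words (c i)) \<le> S" using assms by (simp add: holds_def)
  then show "length (fst (c i)) + length (snd (c i)) \<le> S" by (simp add: words_def)
qed

lemma holds_view:
  assumes "holds M c L" "i < M"
  shows "Pt ` points (view_words (c i)) = Pt ` set (L i)"
  using assms by (auto simp: points_def holds_def simp flip: set_words)

text \<open>After the local sort the \<open>j\<close>-th point of machine \<open>i\<close> sits at
  position \<open>i * B + j\<close>. In the network, messages name only the target machine: the
  offset inside its block may be forgotten because the receiver sorts again.\<close>

definition sort_route :: "nat \<Rightarrow> (nat \<Rightarrow> nat) \<Rightarrow> ('p \<Rightarrow> nat) \<Rightarrow> 'p step" where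
  "sort_route B d key i v = (let xs = sort_key key (pts (words v)) in
     ([], map (\<lambda>j. (d (i * B + j), Pt (xs ! j))) [0..<length xs]))"

definition route :: "nat \<Rightarrow> nat \<Rightarrow> (nat \<Rightarrow> nat) \<Rightarrow> ('p \<Rightarrow> nat) \<Rightarrow> (nat \<Rightarrow> 'p list) \<Rightarrow> nat \<Rightarrow> 'p list" where
  "route M B d key L k = concat (map (\<lambda>i. map ((!) (sort_key key (L i)))
     (filter (\<lambda>j. d (i * B + j) = k) [0..<length (L i)])) [0..<M])"

lemma sort_route_step:
  assumes "holds M c L" "\<And>i. i < M \<Longrightarrow> length (L i) \<le> B"
    and "\<And>i j. i < M \<Longrightarrow> j < length (L i) \<Longrightarrow> d (i * B + j) < M"
  shows "legal_step M B (sort_route B d key) c"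
    and "holds M (advance M (sort_route B d key) c) (route M B d key L)"
proof -
  have st: "sort_route B d key i (c i) =
      ([], map (\<lambda>j. (d (i * B + j), Pt (sort_key key (L i) ! j))) [0..<length (L i)])" if "i < M" for i
    using assms(1) that by (simp add: sort_route_def holds_def Let_def)
  show "legal_step M B (sort_route B d key) c"
    unfolding legal_step_def
  proof (intro allI impI)
    fix i assume i: "i < M"
    have "Pt (sort_key key (L i) ! j) \<in> Pt ` set (L i)" if "j < length (L i)" for j
      using that nth_mem[of j "sort_key key (L i)"] by simp
    then show "length (snd (sort_route B d key i (c i))) \<le> B \<and>
       (\<forall>k\<in>fst ` set (snd (sort_route B d key i (c i))). k < M) \<and>
       set (fst (sort_route B d key i (c i))) \<union> snd ` set (snd (sort_route B d key i (c i)))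
       \<subseteq> Pt ` points (view_words (c i))"
      using assms(2,3) i unfolding st[OF i] holds_view[OF assms(1) i] by auto
  qed
  show "holds M (advance M (sort_route B d key) c) (route M B d key L)"
    unfolding holds_def
  proof (intro allI impI)
    fix k assume k: "k < M"
    have aux: "map snd (concat (map (\<lambda>(k', w). if k' = k then [(i, w)] else [])
        (map (\<lambda>j. (D j, Pt (xs ! j))) js))) = map Pt (map ((!) xs) (filter (\<lambda>j. D j = k) js))"
      for i D js and xs :: "'a list"
      by (induction js) auto
    have aux2: "map snd (concat (map F is)) = concat (map (\<lambda>i. map snd (F i)) is)" for F :: "nat \<Rightarrow> (nat \<times> 'a word) list" and "is"
      by (simp add: map_concat comp_def)
    have aux3: "concat (map (\<lambda>i. map Pt (G i)) is) = map Pt (concat (map G is))" for G :: "nat \<Rightarrow> 'a list" and "is"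
      by (simp add: map_concat comp_def)
    let ?O = "\<lambda>i. if i < M then sort_route B d key i (c i) else ([], [])"
    have "words (advance M (sort_route B d key) c k) =
        map snd (concat (map (\<lambda>i. concat (map (\<lambda>(k', w). if k' = k then [(i, w)] else []) (snd (?O i)))) [0..<M]))"
      using k by (simp add: words_def advance_def deliver_def st)
    also have "\<dots> = concat (map (\<lambda>i. map snd (concat (map (\<lambda>(k', w). if k' = k then [(i, w)] else []) (snd (?O i))))) [0..<M])"
      by (rule aux2)
    also have "\<dots> = concat (map (\<lambda>i. map Pt (map ((!) (sort_key key (L i)))
        (filter (\<lambda>j. d (i * B + j) = k) [0..<length (L i)]))) [0..<M])"
    proof (rule arg_cong[of _ _ concat], rule map_cong[OF refl])
      fix i assume "i \<in> set [0..<M]"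
      then have i: "i < M" by simp
      then have "snd (?O i) = map (\<lambda>j. (d (i * B + j), Pt (sort_key key (L i) ! j))) [0..<length (L i)]"
        by (simp add: st)
      then show "map snd (concat (map (\<lambda>(k', w). if k' = k then [(i, w)] else []) (snd (?O i)))) =
        map Pt (map ((!) (sort_key key (L i))) (filter (\<lambda>j. d (i * B + j) = k) [0..<length (L i)]))"
        by (simp only: aux)
    qed
    also have "\<dots> = map Pt (route M B d key L k)"
      by (simp only: aux3 route_def)
    finally show "words (advance M (sort_route B d key) c k) = map Pt (route M B d key L k)" .
  qed
qed

section \<open>Machines as blocks of positions\<close>

definition opt_mset :: "'a option \<Rightarrow> 'a multiset" where
  "opt_mset z = (case z of None \<Rightarrow> {#} | Some x \<Rightarrow> {#x#})"

lemma opt_mset_simps [simp]: "opt_mset None = {#}" "opt_mset (Some x) = {#x#}"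
  by (simp_all add: opt_mset_def)

definition slot :: "nat \<Rightarrow> ('p \<Rightarrow> nat) \<Rightarrow> (nat \<Rightarrow> 'p list) \<Rightarrow> nat \<Rightarrow> 'p option" where
  "slot B key L x = (if x mod B < length (L (x div B)) then Some (sort_key key (L (x div B)) ! (x mod B)) else None)"

text \<open>\<open>A\<close> places points at positions such that machine \<open>i\<close> holds
  those of its block, in any order. A receiver knows no more than this.\<close>

definition cover :: "nat \<Rightarrow> (nat \<Rightarrow> 'p list) \<Rightarrow> (nat \<Rightarrow> 'p option) \<Rightarrow> bool" where
  "cover B L A \<longleftrightarrow> (\<forall>i. mset (L i) = (\<Sum>x\<in>{i * B..<i * B + B}. opt_mset (A x)))"

lemma sum_block: "(\<Sum>x\<in>{i * B..<i * B + B}. f x) = (\<Sum>j<B. f (i * B + j :: nat))"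
  using sum.shift_bounds_nat_ivl[of f 0 "i * B" B] by (simp add: atLeast0LessThan add.commute)

lemma mset_map_upt: "mset (map h [a..<b]) = (\<Sum>x\<in>{a..<b}. {#h x#})"
  by (induction b) (auto simp: atLeastLessThanSuc)

lemma mset_filter_upt:
  "mset (map g (filter P [0..<n])) = (\<Sum>j<n. if P j then {#g j#} else {#})"
  by (induction n) (auto simp: lessThan_Suc add.commute)

lemma slot_block: "j < B \<Longrightarrow> slot B key L (i * B + j) = (if j < length (L i) then Some (sort_key key (L i) ! j) else None)"
  by (simp add: slot_def)

lemma mset_route_block:
  assumes "length (L i) \<le> B"
  shows "mset (map ((!) (sort_key key (L i))) (filter P [0..<length (L i)])) =
    (\<Sum>j<B. if P j then opt_mset (slot B key L (i * B + j)) else {#})"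
proof -
  have "(\<Sum>j<B. if P j then opt_mset (slot B key L (i * B + j)) else {#})
    = (\<Sum>j<length (L i). if P j then opt_mset (slot B key L (i * B + j)) else {#})"
    using assms by (intro sum.mono_neutral_right) (auto simp: slot_block)
  also have "\<dots> = (\<Sum>j<length (L i). if P j then {#sort_key key (L i) ! j#} else {#})"
    using assms by (intro sum.cong) (auto simp: slot_block)
  finally show ?thesis by (simp only: mset_filter_upt)
qed

lemma cover_slot:
  assumes "\<And>i. length (L i) \<le> B"
  shows "cover B L (slot B key L)"
  unfolding cover_def
proof
  fix i
  have "mset (L i) = mset (map ((!) (sort_key key (L i))) (filter (\<lambda>_. True) [0..<length (L i)]))"
    using map_nth[of "sort_key key (L i)"] by simp
  also have "\<dots> = (\<Sum>j<B. opt_mset (slot B key L (i * B + j)))"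
    using mset_route_block[where P = "\<lambda>_. True", OF assms] by simp
  finally show "mset (L i) = (\<Sum>x\<in>{i * B..<i * B + B}. opt_mset (slot B key L x))"
    by (simp add: sum_block)
qed

lemma mset_route:
  assumes "\<And>i. i < M \<Longrightarrow> length (L i) \<le> B"
  shows "mset (route M B d key L k) = (\<Sum>y<M * B. if d y = k then opt_mset (slot B key L y) else {#})"
proof -
  have "mset (route M B d key L k) = (\<Sum>i<M. mset (map ((!) (sort_key key (L i)))
     (filter (\<lambda>j. d (i * B + j) = k) [0..<length (L i)])))"
    by (simp add: route_def mset_concat comp_def interv_sum_list_conv_sum_set_nat atLeast0LessThan)
  also have "\<dots> = (\<Sum>i<M. \<Sum>j<B. if d (i * B + j) = k then opt_mset (slot B key L (i * B + j)) else {#})"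
    using assms by (intro sum.cong refl mset_route_block) auto
  also have "\<dots> = (\<Sum>i<M. \<Sum>x\<in>{i * B..<i * B + B}. if d x = k then opt_mset (slot B key L x) else {#})"
    by (simp add: sum_block)
  finally show ?thesis by (simp add: sum.nat_group)
qed

text \<open>The positions sent to machine \<open>k\<close> are the preimage of its block under the
  bijection \<open>f\<close>, that is, the image under \<open>g\<close>. So the block holds what the
  permuted sequence prescribes, up to order.\<close>

lemma route_cover:
  assumes "\<And>i. length (L i) \<le> B" "\<And>i. M \<le> i \<Longrightarrow> L i = []" "0 < B"
    and fg: "\<And>x. f (g x) = x" "\<And>x. g (f x) = x"
  shows "cover B (route M B (\<lambda>y. f y div B) key L) (slot B key L \<circ> g)"
  unfolding cover_def
proof
  fix k
  let ?K = "{k * B..<k * B + B}"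
  let ?o = "\<lambda>y. opt_mset (slot B key L y)"
  have K: "x \<in> ?K \<longleftrightarrow> x div B = k" for x using assms(3) by (simp add: div_eq_iff_block)
  have gK: "g ` ?K = {y. f y div B = k}"
  proof (intro set_eqI iffI)
    fix y assume "y \<in> {y. f y div B = k}"
    then have "f y \<in> ?K" using K[of "f y"] by blast
    then show "y \<in> g ` ?K" using fg(2)[of y] by (metis imageI)
  next
    fix y assume "y \<in> g ` ?K"
    then obtain x where "x \<in> ?K" "y = g x" by blast
    then show "y \<in> {y. f y div B = k}" using K[of x] fg(1)[of x] by simp
  qed
  have "inj_on g ?K" using fg by (metis inj_onI)
  then have "(\<Sum>x\<in>?K. ?o (g x)) = (\<Sum>y\<in>g ` ?K. ?o y)" by (simp add: sum.reindex)
  also note gK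
  also have "(\<Sum>y\<in>{y. f y div B = k}. ?o y) = (\<Sum>y\<in>{y. y < M * B \<and> f y div B = k}. ?o y)"
  proof (rule sum.mono_neutral_right)
    show "finite {y. f y div B = k}" unfolding gK[symmetric] by simp
    show "\<forall>y\<in>{y. f y div B = k} - {y. y < M * B \<and> f y div B = k}. ?o y = {#}"
    proof
      fix y assume "y \<in> {y. f y div B = k} - {y. y < M * B \<and> f y div B = k}"
      then have "M * B \<le> y" by auto
      then have "M \<le> y div B" using assms(3) by (simp add: less_eq_div_iff_mult_less_eq not_less)
      then show "?o y = {#}" using assms(2) by (simp add: slot_def)
    qed
  qed auto
  also have "\<dots> = (\<Sum>y<M * B. if f y div B = k then ?o y else {#})"
    by (subst sum.inter_filter[symmetric]) (auto intro!: sum.cong)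
  finally show "mset (route M B (\<lambda>y. f y div B) key L k) = (\<Sum>x\<in>?K. opt_mset ((slot B key L \<circ> g) x))"
    using assms(1) by (simp add: mset_route)
qed

text \<open>Unused slots carry the key \<open>\<infinity>\<close>, so a machine may hold fewer than \<open>B\<close> points and sends no dummies.\<close>

definition okey :: "('p \<Rightarrow> nat) \<Rightarrow> 'p option \<Rightarrow> enat" where
  "okey key z = (case z of None \<Rightarrow> \<infinity> | Some p \<Rightarrow> enat (key p))"

lemma okey_simps [simp]: "okey key None = \<infinity>" "okey key (Some p) = enat (key p)"
  by (simp_all add: okey_def)

text \<open>Each empty position contributes one key \<infinity>; the size bound makes the truncated
  subtraction exact.\<close>

lemma mset_okey:
  assumes "finite X"
  shows "size (\<Sum>x\<in>X. opt_mset (A x)) \<le> card X \<and> (\<Sum>x\<in>X. {#okey key (A x)#}) =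
    image_mset (\<lambda>p. enat (key p)) (\<Sum>x\<in>X. opt_mset (A x)) +
    replicate_mset (card X - size (\<Sum>x\<in>X. opt_mset (A x))) \<infinity>"
  using assms
proof (induction X)
  case (insert x X)
  then show ?case by (cases "A x") (auto simp: Suc_diff_le)
qed simp

text \<open>Sorting the points of a machine realises one comparator layer on the keys, since the
  infinite keys of empty positions belong at the end, where \<open>slot\<close> has
  \<open>None\<close>. The length bound is the benefit of obliviousness: a block of \<open>B\<close>
  positions cannot overload its machine.\<close>

lemma okey_slot:
  assumes "cover B L A" "0 < B"
  shows "okey key \<circ> slot B key L = bsort B (okey key \<circ> A)" and "length (L i) \<le> B"
proof -
  have len: "length (L i) \<le> B" for i
  proof -
    have "size (mset (L i)) \<le> card {i * B..<i * B + B}"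
      using mset_okey[of "{i * B..<i * B + B}"] assms(1) by (metis cover_def finite_atLeastLessThan)
    then show ?thesis by simp
  qed
  show "length (L i) \<le> B" by (rule len)
  show "okey key \<circ> slot B key L = bsort B (okey key \<circ> A)"
  proof
    fix x
    define i where "i = x div B"
    let ?K = "{i * B..<i * B + B}"
    have "sort (map (okey key \<circ> A) [i * B..<i * B + B]) =
      map (\<lambda>p. enat (key p)) (sort_key key (L i)) @ replicate (B - length (L i)) \<infinity>"
    proof (rule properties_for_sort)
      have "mset (map (okey key \<circ> A) [i * B..<i * B + B]) = (\<Sum>x\<in>?K. {#okey key (A x)#})"
        unfolding mset_map_upt by simp
      also have "\<dots> = image_mset (\<lambda>p. enat (key p)) (mset (L i)) + replicate_mset (B - length (L i)) \<infinity>"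
      proof -
        have m: "mset (L i) = (\<Sum>x\<in>?K. opt_mset (A x))" using assms(1) by (simp add: cover_def)
        have "size (mset (L i)) = length (L i)" "card ?K = B" by simp_all
        then show ?thesis using mset_okey[of ?K A key] unfolding m[symmetric] by simp
      qed
      finally show "mset (map (\<lambda>p. enat (key p)) (sort_key key (L i)) @ replicate (B - length (L i)) \<infinity>)
        = mset (map (okey key \<circ> A) [i * B..<i * B + B])" by simp
      have "sorted (map key (sort_key key (L i)))" by simp
      then have "sorted (map enat (map key (sort_key key (L i))))"
        by (simp add: sorted_iff_nth_mono)
      then show "sorted (map (\<lambda>p. enat (key p)) (sort_key key (L i)) @ replicate (B - length (L i)) \<infinity>)"
        by (simp add: sorted_append comp_def)
    qed
    then show "(okey key \<circ> slot B key L) x = bsort B (okey key \<circ> A) x"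
      using assms(2) len[of i] mod_less_divisor[OF assms(2), of x] by (auto simp: bsort_def slot_def i_def[symmetric] nth_append)
  qed
qed

lemma sum_cover:
  assumes "cover B L A"
  shows "(\<Sum>i<M. mset (L i)) = (\<Sum>y<M * B. opt_mset (A y))"
  using assms by (simp add: cover_def sum.nat_group)

text \<open>The invariant is a placement linked to the lists by \<open>cover\<close>: the keys
  follow \<open>exec\<close>, and \<open>okey_slot\<close> bounds the load of every machine after
  every routing.\<close>

lemma network_run:
  fixes key :: "'p \<Rightarrow> nat"
  assumes "cover B L A" "\<And>i. M \<le> i \<Longrightarrow> L i = []" "0 < B" "holds M c L"
    and "\<And>f g x. (f, g) \<in> set ps \<Longrightarrow> f (g x) = x \<and> g (f x) = x \<and> (x < M * B \<longrightarrow> f x < M * B)"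
  defines "sts \<equiv> map (\<lambda>(f, g). sort_route B (\<lambda>y. f y div B) key) ps"
  shows "\<exists>L' A'. holds M (fold (advance M) sts c) L' \<and> legal M B c sts \<and> cover B L' A' \<and>
    (\<forall>i\<ge>M. L' i = []) \<and> okey key \<circ> slot B key L' = exec B ps (okey key \<circ> A) \<and>
    (\<Sum>i<M. mset (L' i)) = (\<Sum>i<M. mset (L i))"
  unfolding sts_def using assms(1,2,4,5)
proof (induction ps arbitrary: L A c)
  case Nil
  note len = okey_slot(2)[OF Nil(1) assms(3)]
  have "fits M B c" using holds_fits[OF Nil(3)] len by blast
  then show ?case
    using Nil okey_slot(1)[OF Nil(1) assms(3), of key] by (intro exI[of _ L] exI[of _ A]) (simp add: comp_def)
next
  case (Cons p ps)
  obtain f g where p: "p = (f, g)" by fastforce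
  have fg: "f (g x) = x" "g (f x) = x" "x < M * B \<Longrightarrow> f x < M * B" for x
    using Cons.prems(4)[of f g x] p by auto
  note len = okey_slot(2)[OF Cons.prems(1) assms(3)]
  let ?d = "\<lambda>y. f y div B"
  have dest: "f (i * B + j) div B < M" if "i < M" "j < length (L i)" for i j
  proof -
    have "i * B + j < Suc i * B" using that(2) len[of i] by simp
    also have "\<dots> \<le> M * B" using that(1) by (intro mult_le_mono1) simp
    finally show ?thesis using fg(3) by (simp add: less_mult_imp_div_less)
  qed
  note step = sort_route_step[OF Cons.prems(3), of B "?d" key, OF len dest]
  let ?L = "route M B ?d key L" and ?A = "slot B key L \<circ> g"
  have cov: "cover B ?L ?A" using route_cover[OF len Cons.prems(2) assms(3) fg(1,2)] .
  have nil: "?L k = []" if "M \<le> k" for k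
  proof -
    have "?d (i * B + j) \<noteq> k" if "i < M" "j < length (L i)" for i j
      using dest[OF that] \<open>M \<le> k\<close> by simp
    then show ?thesis by (simp add: route_def)
  qed
  \<comment> \<open>Summing over the target machines counts each position below \<open>M * B\<close>
    once, because \<open>f\<close> does not leave this range; no point is lost.\<close>
  have total: "(\<Sum>i<M. mset (?L i)) = (\<Sum>i<M. mset (L i))"
  proof -
    have "(\<Sum>k<M. mset (?L k)) = (\<Sum>k<M. \<Sum>y<M * B. if ?d y = k then opt_mset (slot B key L y) else {#})"
      using len by (simp add: mset_route)
    also have "\<dots> = (\<Sum>y<M * B. \<Sum>k<M. if ?d y = k then opt_mset (slot B key L y) else {#})"
      by (rule sum.swap)
    also have "\<dots> = (\<Sum>y<M * B. opt_mset (slot B key L y))"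
      using fg(3) by (intro sum.cong) (simp_all add: less_mult_imp_div_less)
    also have "\<dots> = (\<Sum>i<M. mset (L i))"
      using sum_cover[where M = M, OF cover_slot[where key = key, OF len]] by simp
    finally show ?thesis .
  qed
  let ?st = "sort_route B ?d key"
  have ih: "\<exists>L' A'. holds M (fold (advance M) (map (\<lambda>(f, g). sort_route B (\<lambda>y. f y div B) key) ps) (advance M ?st c)) L' \<and>
    legal M B (advance M ?st c) (map (\<lambda>(f, g). sort_route B (\<lambda>y. f y div B) key) ps) \<and> cover B L' A' \<and>
    (\<forall>i\<ge>M. L' i = []) \<and> okey key \<circ> slot B key L' = exec B ps (okey key \<circ> ?A) \<and>
    (\<Sum>i<M. mset (L' i)) = (\<Sum>i<M. mset (?L i))"
    using Cons.prems(4) by (intro Cons.IH[OF cov nil step(2)]) auto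
  have "okey key \<circ> ?A = bsort B (okey key \<circ> A) \<circ> g"
    by (simp only: okey_slot(1)[OF Cons.prems(1) assms(3), symmetric] comp_assoc)
  moreover have "fits M B c" using holds_fits[OF Cons.prems(3)] len by blast
  ultimately show ?case using ih step(1) total by (simp add: p comp_def)
qed

text \<open>The shape of a configuration between two passes: all points in kept memory and no
  messages pending, as in the input and when the output is read.\<close>

definition stores :: "nat \<Rightarrow> nat \<Rightarrow> (nat \<Rightarrow> 'p view) \<Rightarrow> 'p set \<Rightarrow> bool" where
  "stores M S c Q \<longleftrightarrow> finite Q \<and> (\<exists>L. (\<forall>i<M. c i = (map Pt (L i), []) \<and> length (L i) \<le> S) \<and>
     (\<Sum>i<M. mset (L i)) = mset_set Q)"

text \<open>In the last step a position is used as the index of a machine: the sorted points occupy an initial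
  segment of the positions, and there are at least as many machines as points.\<close>

lemma sorted_spread:
  fixes key :: "'p \<Rightarrow> nat"
  assumes "stores M B c Q" "card Q \<le> M" "B = 2 * (s * s)" "0 < s" "M = s ^ l"
  defines "sts \<equiv> map (\<lambda>(f, g). sort_route B (\<lambda>y. f y div B) key) (net B s l) @ [sort_route B (\<lambda>x. x) key]"
  shows "\<exists>W. mset W = mset_set Q \<and> sorted (map key W) \<and>
    holds M (fold (advance M) sts c) (\<lambda>x. if x < length W then [W ! x] else []) \<and> legal M B c sts"
proof -
  obtain L0 where L0: "\<And>i. i < M \<Longrightarrow> c i = (map Pt (L0 i), [])" "\<And>i. i < M \<Longrightarrow> length (L0 i) \<le> B"
    "(\<Sum>i<M. mset (L0 i)) = mset_set Q" using assms(1) by (auto simp: stores_def)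
  define L where "L i = (if i < M then L0 i else [])" for i
  have B: "0 < B" "0 < M" using assms by simp_all
  have len: "length (L i) \<le> B" for i using L0(2) by (simp add: L_def)
  have Lnil: "L i = []" if "M \<le> i" for i using that by (simp add: L_def)
  have hold: "holds M c L" using L0(1) by (simp add: holds_def words_def L_def)
  have tot: "(\<Sum>i<M. mset (L i)) = mset_set Q" using L0(3) by (simp add: L_def)
  have perm: "f (g x) = x \<and> g (f x) = x \<and> (x < M * B \<longrightarrow> f x < M * B)" if "(f, g) \<in> set (net B s l)" for f g x
  proof -
    note n = net_perm[OF assms(3,4) that, of x]
    have MB: "B * s ^ l = M * B" using assms(5) by simp
    have "f x < M * B" if "x < M * B"
    proof -
      have "f x div (M * B) = 0" using n(3) that unfolding MB by simp
      then show ?thesis using B by (simp add: div_eq_0_iff)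
    qed
    then show ?thesis using n by simp
  qed
  define net_sts where "net_sts = map (\<lambda>(f, g). sort_route B (\<lambda>y. f y div B) key) (net B s l)"
  obtain L' A' where L': "holds M (fold (advance M) net_sts c) L'" "legal M B c net_sts" "cover B L' A'"
    "\<And>i. M \<le> i \<Longrightarrow> L' i = []" "okey key \<circ> slot B key L' = exec B (net B s l) (okey key \<circ> slot B key L)"
    "(\<Sum>i<M. mset (L' i)) = mset_set Q"
    using network_run[where ps = "net B s l" and key = key,
        OF cover_slot[where key = key, OF len] Lnil B(1) hold perm]
    unfolding net_sts_def tot by blast
  note len' = okey_slot(2)[OF L'(3) B(1)]
  define sl where "sl = slot B key L'"
  have mono: "okey key (sl x) \<le> okey key (sl y)" if "x \<le> y" "y < M * B" for x y
    using exec_net_mono[OF assms(3,4) that(1), of l "okey key \<circ> slot B key L"] that(2)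
    by (simp add: assms(5) sl_def mult.commute flip: L'(5))
  have none: "sl x = None" if "M * B \<le> x" for x
    using that B L'(4) by (simp add: sl_def slot_def less_eq_div_iff_mult_less_eq)
  \<comment> \<open>The first empty position. Empty positions have the largest key, so by
    monotonicity all later ones are empty too, and \<open>k\<close> is the number of points.\<close>
  define k where "k = (LEAST x. sl x = None)"
  have k: "sl k = None" unfolding k_def by (rule LeastI[of _ "M * B"]) (simp add: none)
  have kN: "k \<le> M * B" unfolding k_def by (rule Least_le) (simp add: none)
  have some: "sl x \<noteq> None" if "x < k" for x using that not_less_Least unfolding k_def by blast
  have none': "sl x = None" if "k \<le> x" for x
  proof (cases "x < M * B")
    case True
    then show ?thesis using mono[OF that True] k by (cases "sl x") auto
  qed (simp add: none)
  define W where "W = map (\<lambda>x. the (sl x)) [0..<k]"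
  have lenW: "length W = k" by (simp add: W_def)
  have slW: "sl x = (if x < length W then Some (W ! x) else None)" for x
    using some[of x] none'[of x] by (auto simp: W_def)
  have cs: "cover B L' sl" unfolding sl_def by (rule cover_slot[OF len'])
  have "mset W = (\<Sum>x<length W. {#W ! x#})"
    using mset_map_upt[of "(!) W" 0 "length W"] map_nth[of W] by (simp add: atLeast0LessThan)
  also have "\<dots> = (\<Sum>x<length W. opt_mset (sl x))"
    by (intro sum.cong) (simp_all add: slW)
  also have "\<dots> = (\<Sum>x<M * B. opt_mset (sl x))"
    using kN by (intro sum.mono_neutral_left) (auto simp: slW lenW)
  also have "\<dots> = mset_set Q" using sum_cover[OF cs, of M] L'(6) by simp
  finally have W: "mset W = mset_set Q" .
  have "length W = card Q" using W by (metis size_mset size_mset_set)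
  then have kM: "k \<le> M" using assms(2) by (simp add: lenW)
  have sW: "sorted (map key W)"
    unfolding sorted_iff_nth_mono
  proof (intro allI impI)
    fix i j assume "i \<le> j" "j < length (map key W)"
    then show "map key W ! i \<le> map key W ! j"
      using mono[of i j] kN by (simp add: slW lenW)
  qed
  have dest: "i * B + j < M" if "i < M" "j < length (L' i)" for i j
  proof -
    have "sl (i * B + j) \<noteq> None" using that len'[of i] by (simp add: sl_def slot_block)
    then have "i * B + j < k" using none' by (meson not_less)
    then show ?thesis using kM by simp
  qed
  note step = sort_route_step[OF L'(1) len', of "\<lambda>x. x" key, OF dest]
  have "route M B (\<lambda>x. x) key L' x = (if x < length W then [W ! x] else [])" if "x < M" for x
  proof -
    have "x < M * B" using that B by (metis le_add1 less_le_trans mult.right_neutral mult_le_mono2 Suc_leI One_nat_def)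
    then have "mset (route M B (\<lambda>x. x) key L' x) = opt_mset (sl x)"
      using len' by (simp add: mset_route sl_def)
    then show ?thesis unfolding slW by (auto split: if_splits)
  qed
  then have "holds M (fold (advance M) sts c) (\<lambda>x. if x < length W then [W ! x] else [])"
    using step(2) by (simp add: holds_def sts_def flip: net_sts_def)
  moreover have "legal M B c sts"
    unfolding sts_def net_sts_def[symmetric]
  proof (rule legal_append[OF L'(2)])
    have "holds M (advance M (sort_route B (\<lambda>x. x) key) (fold (advance M) net_sts c))
      (\<lambda>x. if x < length W then [W ! x] else [])" using calculation by (simp add: sts_def flip: net_sts_def)
    then have "fits M B (advance M (sort_route B (\<lambda>x. x) key) (fold (advance M) net_sts c))"
      by (rule holds_fits) (use B in auto)
    then show "legal M B (fold (advance M) net_sts c) [sort_route B (\<lambda>x. x) key]"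
      using holds_fits[OF L'(1) len'] step(1) by simp
  qed
  ultimately show ?thesis using W sW by blast
qed

section \<open>Thinning a sorted point set\<close>

definition copy_right :: "nat \<Rightarrow> 'p step" where
  "copy_right M i v = (let xs = pts (words v) in
     (map Pt xs, if Suc i < M then map (\<lambda>p. (Suc i, Pt p)) xs else []))"

text \<open>The machine's own point is in \<open>fst v\<close>, the copy of the predecessor in
  \<open>snd v\<close>; the copy is discarded in any case.\<close>

definition drop_close :: "('p::metric_space \<Rightarrow> nat) \<Rightarrow> real \<Rightarrow> 'p step" where
  "drop_close key r i v = (map Pt (filter (\<lambda>p. \<not> (\<exists>q\<in>set (pts (map snd (snd v))).
     key q = key p \<and> dist q p \<le> 2 * r)) (pts (fst v))), [])"

text \<open>The comparison is with the predecessor in \<open>W\<close> whether or not that one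
  survives, so all points decide in the same round.\<close>

definition kept :: "('p::metric_space \<Rightarrow> nat) \<Rightarrow> real \<Rightarrow> 'p list \<Rightarrow> nat \<Rightarrow> bool" where
  "kept key r W j \<longleftrightarrow> \<not> (0 < j \<and> key (W ! (j - 1)) = key (W ! j) \<and> dist (W ! (j - 1)) (W ! j) \<le> 2 * r)"

definition survivors :: "('p::metric_space \<Rightarrow> nat) \<Rightarrow> real \<Rightarrow> 'p list \<Rightarrow> 'p set" where
  "survivors key r W = {W ! j | j. j < length W \<and> kept key r W j}"

lemma copy_drop:
  fixes W :: "'p::metric_space list"
  assumes "holds M c (\<lambda>x. if x < length W then [W ! x] else [])" "distinct W" "length W \<le> M" "2 \<le> S"
  shows "legal M S c [copy_right M, drop_close key r]"
    and "stores M S (fold (advance M) [copy_right M, drop_close key r] c) (survivors key r W)"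
proof -
  define L where "L x = (if x < length W then [W ! x] else [])" for x
  have h: "holds M c L" using assms(1) by (simp add: L_def[abs_def])
  have lenL: "length (L x) \<le> 1" for x by (simp add: L_def)
  have st: "copy_right M i (c i) = (map Pt (L i), if Suc i < M then map (\<lambda>p. (Suc i, Pt p)) (L i) else [])"
    if "i < M" for i using h that by (simp add: copy_right_def holds_def Let_def)
  define c1 where "c1 = advance M (copy_right M) c"
  have c1: "c1 x = (map Pt (L x), if x = 0 then [] else map (\<lambda>p. (x - 1, Pt p)) (L (x - 1)))" if "x < M" for x
  proof -
    let ?O = "\<lambda>i. if i < M then copy_right M i (c i) else ([], [])"
    have "concat (map (\<lambda>i. concat (map (\<lambda>(k', w). if k' = x then [(i, w)] else []) (snd (?O i)))) [0..<M])
      = concat (map (\<lambda>i. if Suc i = x then map (\<lambda>p. (i, Pt p)) (L i) else []) [0..<M])"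
    proof (rule arg_cong[of _ _ concat], rule map_cong[OF refl])
      fix i assume "i \<in> set [0..<M]"
      then have "i < M" by simp
      then show "concat (map (\<lambda>(k', w). if k' = x then [(i, w)] else []) (snd (?O i)))
        = (if Suc i = x then map (\<lambda>p. (i, Pt p)) (L i) else [])"
        using that by (auto simp: st L_def)
    qed
    also have "\<dots> = (if x = 0 then [] else map (\<lambda>p. (x - 1, Pt p)) (L (x - 1)))"
    proof (cases x)
      case (Suc y)
      have up: "[0..<M] = [0..<y] @ y # [Suc y..<M]"
        using that Suc upt_add_eq_append[of 0 y "M - y"] upt_conv_Cons[of y M] by simp
      have z: "concat (map (\<lambda>i. if Suc i = x then map (\<lambda>p. (i, Pt p)) (L i) else []) [0..<y]) = []"
        "concat (map (\<lambda>i. if Suc i = x then map (\<lambda>p. (i, Pt p)) (L i) else []) [Suc y..<M]) = []"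
        using Suc by (auto simp: concat_eq_Nil_conv)
      show ?thesis
        unfolding up map_append concat_append list.map concat.simps z using Suc by simp
    qed simp
    finally show ?thesis using that by (simp add: c1_def advance_def deliver_def st)
  qed
  define c2 where "c2 = advance M (drop_close key r) c1"
  define L2 where "L2 x = (if x < length W \<and> kept key r W x then [W ! x] else [])" for x
  have d: "drop_close key r x (c1 x) = (map Pt (L2 x), [])" if x: "x < M" for x
  proof -
    have "map snd (snd (c1 x)) = map Pt (if x = 0 then [] else L (x - 1))"
      using c1[OF x] by (simp add: comp_def)
    then have "pts (map snd (snd (c1 x))) = (if x = 0 then [] else L (x - 1))" by (simp only: pts_map_Pt)
    moreover have "pts (fst (c1 x)) = L x" using c1[OF x] by simp
    ultimately show ?thesis by (auto simp: drop_close_def L_def L2_def kept_def)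
  qed
  have c2: "c2 x = (map Pt (L2 x), [])" if "x < M" for x
  proof -
    have "concat (map (\<lambda>i. concat (map (\<lambda>(k', w). if k' = x then [(i, w)] else [])
        (snd (if i < M then drop_close key r i (c1 i) else ([], []))))) [0..<M]) = []"
      by (auto simp: d)
    then show ?thesis using that by (simp add: c2_def advance_def deliver_def d)
  qed
  have "fits M S c" using holds_fits[OF h, of S] lenL assms(4) by (meson le_trans one_le_numeral)
  moreover have "fits M S c1"
    unfolding fits_def
  proof (intro allI impI)
    fix i assume "i < M"
    then show "length (fst (c1 i)) + length (snd (c1 i)) \<le> S"
      using c1[of i] lenL[of i] lenL[of "i - 1"] assms(4) by auto
  qed
  moreover have "fits M S c2" using c2 assms(4) by (auto simp: fits_def L2_def)
  moreover have "legal_step M S (copy_right M) c"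
    unfolding legal_step_def
  proof (intro allI impI)
    fix i assume i: "i < M"
    show "length (snd (copy_right M i (c i))) \<le> S \<and> (\<forall>k\<in>fst ` set (snd (copy_right M i (c i))). k < M) \<and>
       set (fst (copy_right M i (c i))) \<union> snd ` set (snd (copy_right M i (c i))) \<subseteq> Pt ` points (view_words (c i))"
      using lenL[of i] assms(4) unfolding st[OF i] holds_view[OF h i] by auto
  qed
  moreover have "legal_step M S (drop_close key r) c1"
    unfolding legal_step_def
  proof (intro allI impI)
    fix i assume i: "i < M"
    have "set (L2 i) \<subseteq> points (view_words (c1 i))"
      using c1[OF i] by (auto simp: L2_def L_def points_def view_words_def)
    then show "length (snd (drop_close key r i (c1 i))) \<le> S \<and> (\<forall>k\<in>fst ` set (snd (drop_close key r i (c1 i))). k < M) \<and>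
       set (fst (drop_close key r i (c1 i))) \<union> snd ` set (snd (drop_close key r i (c1 i))) \<subseteq> Pt ` points (view_words (c1 i))"
      unfolding d[OF i] by auto
  qed
  ultimately show "legal M S c [copy_right M, drop_close key r]"
    by (simp flip: c1_def c2_def)
  have surv: "survivors key r W = (!) W ` {j. j < length W \<and> kept key r W j}"
    by (auto simp: survivors_def)
  have inj: "inj_on ((!) W) {j. j < length W \<and> kept key r W j}"
    using assms(2) by (auto intro!: inj_onI simp: nth_eq_iff_index_eq)
  have "(\<Sum>x<M. mset (L2 x)) = (\<Sum>x\<in>{j. j < length W \<and> kept key r W j}. {#W ! x#})"
    using assms(3) by (intro sum.mono_neutral_cong_right) (auto simp: L2_def)
  also have "\<dots> = (\<Sum>p\<in>survivors key r W. {#p#})"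
    unfolding surv by (rule sum.reindex[OF inj, unfolded comp_def, symmetric])
  also have "\<dots> = mset_set (survivors key r W)"
    by (simp add: surv)
  finally have "(\<Sum>x<M. mset (L2 x)) = mset_set (survivors key r W)" .
  moreover have "length (L2 i) \<le> S" for i using assms(4) by (simp add: L2_def)
  ultimately show "stores M S (fold (advance M) [copy_right M, drop_close key r] c) (survivors key r W)"
    using c2 by (auto simp: stores_def surv simp flip: c1_def c2_def)
qed

section \<open>Guarantees of one pass and of a sequence of passes\<close>

definition phase :: "nat \<Rightarrow> nat \<Rightarrow> nat \<Rightarrow> real \<Rightarrow> ('p::metric_space \<Rightarrow> nat) \<Rightarrow> 'p step list" where
  "phase s l M r key = map (\<lambda>(f, g). sort_route (2 * (s * s)) (\<lambda>y. f y div (2 * (s * s))) key)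
      (net (2 * (s * s)) s l) @ [sort_route (2 * (s * s)) (\<lambda>x. x) key] @ [copy_right M, drop_close key r]"

lemma phase_run:
  fixes Q :: "'p::metric_space set"
  assumes "stores M (2 * (s * s)) c Q" "card Q \<le> M" "0 < s" "M = s ^ l"
  shows "\<exists>W. set W = Q \<and> distinct W \<and> sorted (map key W) \<and> legal M (2 * (s * s)) c (phase s l M r key) \<and>
    stores M (2 * (s * s)) (fold (advance M) (phase s l M r key) c) (survivors key r W)"
proof -
  let ?B = "2 * (s * s)"
  let ?sts = "map (\<lambda>(f, g). sort_route ?B (\<lambda>y. f y div ?B) key) (net ?B s l) @ [sort_route ?B (\<lambda>x. x) key]"
  obtain W where W: "mset W = mset_set Q" "sorted (map key W)"
    "holds M (fold (advance M) ?sts c) (\<lambda>x. if x < length W then [W ! x] else [])" "legal M ?B c ?sts"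
    using sorted_spread[OF assms(1,2) refl assms(3,4), of key] by blast
  have Q: "finite Q" using assms(1) by (simp add: stores_def)
  have sW: "set W = Q" using W(1) Q by (metis finite_set_mset_mset_set set_mset_mset)
  have lW: "length W = card Q" using W(1) by (metis size_mset size_mset_set)
  have dW: "distinct W" using sW lW by (simp add: card_distinct)
  have p: "phase s l M r key = ?sts @ [copy_right M, drop_close key r]" by (simp add: phase_def)
  have S: "2 \<le> ?B" using assms(3) by simp
  have "legal M ?B c (phase s l M r key)"
    unfolding p by (rule legal_append[OF W(4) copy_drop(1)[OF W(3) dW _ S]]) (simp add: lW assms(2))
  moreover have "stores M ?B (fold (advance M) (phase s l M r key) c) (survivors key r W)"
  proof -
    have "fold (advance M) (phase s l M r key) c =
      fold (advance M) [copy_right M, drop_close key r] (fold (advance M) ?sts c)"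
      by (simp only: p fold_append comp_apply)
    moreover have "stores M ?B (fold (advance M) [copy_right M, drop_close key r] (fold (advance M) ?sts c))
      (survivors key r W)"
      by (rule copy_drop(2)[OF W(3) dW _ S]) (simp add: lW assms(2))
    ultimately show ?thesis by (simp only:)
  qed
  ultimately show ?thesis using sW dW W(2) by blast
qed

text \<open>A key class either has at most two points or has all its points within
  \<open>2 * r\<close> of each other. The first case fits keys that merge two cells with one point
  each, the second the key given by the cell itself.\<close>

definition thin :: "('p::metric_space \<Rightarrow> nat) \<Rightarrow> real \<Rightarrow> 'p set \<Rightarrow> bool" where
  "thin key r Q \<longleftrightarrow> (\<forall>p\<in>Q. \<forall>q\<in>Q. \<forall>u\<in>Q. key p = key q \<longrightarrow> key q = key u \<longrightarrow>
     p \<noteq> q \<longrightarrow> p \<noteq> u \<longrightarrow> q \<noteq> u \<longrightarrow> dist p q \<le> 2 * r)"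

lemma survivors_subset: "survivors key r W \<subseteq> set W"
  by (auto simp: survivors_def)

text \<open>The first point of a key class survives. It is within \<open>2 * r\<close> of every
  dropped point: either it is the close predecessor, or the class has three points and
  \<open>thin\<close> applies.\<close>

lemma survivors_cover:
  assumes W: "distinct W" "sorted (map key W)" "thin key r (set W)" and r: "0 \<le> r" and q: "q \<in> set W"
  shows "\<exists>p\<in>survivors key r W. dist q p \<le> 2 * r"
proof -
  obtain x where x: "x < length W" "q = W ! x" using q by (metis in_set_conv_nth)
  show ?thesis
  proof (cases "kept key r W x")
    case True
    then have "q \<in> survivors key r W" using x by (auto simp: survivors_def)
    then show ?thesis using r by (intro bexI[of _ q]) auto
  next
    case False
    then have f: "0 < x" "key (W ! (x - 1)) = key (W ! x)" "dist (W ! (x - 1)) (W ! x) \<le> 2 * r"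
      by (auto simp: kept_def)
    define y where "y = (LEAST j. key (W ! j) = key (W ! x))"
    have ky: "key (W ! y) = key (W ! x)" unfolding y_def by (rule LeastI[of _ x]) simp
    have yx: "y \<le> x - 1" unfolding y_def by (rule Least_le) (rule f(2))
    have "key (W ! (y - 1)) \<noteq> key (W ! y)" if "0 < y"
      using not_less_Least[of "y - 1" "\<lambda>j. key (W ! j) = key (W ! x)"] that ky by (simp add: y_def)
    then have "kept key r W y" by (auto simp: kept_def)
    then have ys: "W ! y \<in> survivors key r W" using yx x by (auto simp: survivors_def)
    have "dist q (W ! y) \<le> 2 * r"
    proof (cases "y = x - 1")
      case True
      then show ?thesis using f(3) x by (simp add: dist_commute)
    next
      case False
      then have "W ! x \<noteq> W ! y" "W ! x \<noteq> W ! (x - 1)" "W ! y \<noteq> W ! (x - 1)"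
        using W(1) x yx f(1) by (auto simp: nth_eq_iff_index_eq)
      moreover have "W ! x \<in> set W" "W ! y \<in> set W" "W ! (x - 1) \<in> set W" using x yx by auto
      ultimately show ?thesis using W(3) ky f(2) unfolding thin_def x(2) by metis
    qed
    then show ?thesis using ys by blast
  qed
qed

text \<open>The later of two survivors is far from its predecessor, which has the same key because
  \<open>W\<close> is sorted. If the predecessor is not the other survivor, the class has three
  points and \<open>thin\<close> gives a contradiction.\<close>

lemma survivors_separated:
  assumes W: "distinct W" "sorted (map key W)" "thin key r (set W)"
    and pq: "p \<in> survivors key r W" "q \<in> survivors key r W" "p \<noteq> q" "key p = key q"
  shows "2 * r < dist p q"
proof -
  have *: "2 * r < dist (W ! y) (W ! x)"
    if xy: "y < x" "x < length W" "kept key r W x" "key (W ! y) = key (W ! x)" for x y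
  proof -
    have "key (W ! y) \<le> key (W ! (x - 1))" "key (W ! (x - 1)) \<le> key (W ! x)"
      using xy W(2) sorted_nth_mono[OF W(2), of y "x - 1"] sorted_nth_mono[OF W(2), of "x - 1" x] by auto
    then have k: "key (W ! (x - 1)) = key (W ! x)" using xy(4) by simp
    then have far: "2 * r < dist (W ! (x - 1)) (W ! x)" using xy by (auto simp: kept_def)
    show ?thesis
    proof (cases "y = x - 1")
      case False
      then have "W ! (x - 1) \<noteq> W ! x" "W ! (x - 1) \<noteq> W ! y" "W ! x \<noteq> W ! y"
        using W(1) xy by (auto simp: nth_eq_iff_index_eq)
      moreover have "W ! x \<in> set W" "W ! y \<in> set W" "W ! (x - 1) \<in> set W" using xy by auto
      ultimately have "dist (W ! (x - 1)) (W ! x) \<le> 2 * r" using W(3) k xy(4) unfolding thin_def by metis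
      then show ?thesis using far by simp
    qed (use far in simp)
  qed
  obtain x where x: "x < length W" "kept key r W x" "p = W ! x" using pq(1) by (auto simp: survivors_def)
  obtain y where y: "y < length W" "kept key r W y" "q = W ! y" using pq(2) by (auto simp: survivors_def)
  consider "x < y" | "y < x" using x y pq(3) by (metis linorder_neqE_nat)
  then show ?thesis
  proof cases
    case 1
    then show ?thesis using *[of x y] x y pq(4) by simp
  next
    case 2
    then show ?thesis using *[of y x] x y pq(4) by (simp add: dist_commute)
  qed
qed

lemma thin_subset: "thin key r Q \<Longrightarrow> Q' \<subseteq> Q \<Longrightarrow> thin key r Q'"
  unfolding thin_def by (meson subsetD)

text \<open>Later passes only delete points, so \<open>thin\<close> and the separation won by
  earlier keys persist, while each pass adds at most \<open>2 * r\<close> to the covering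
  radius.\<close>

lemma phases_run:
  fixes Q :: "'p::metric_space set"
  assumes "stores M (2 * (s * s)) c Q" "card Q \<le> M" "0 < s" "M = s ^ l" "0 \<le> r"
    and "\<forall>key\<in>set keys. thin key r Q"
  shows "\<exists>T\<subseteq>Q. legal M (2 * (s * s)) c (concat (map (phase s l M r) keys)) \<and>
    stores M (2 * (s * s)) (fold (advance M) (concat (map (phase s l M r) keys)) c) T \<and>
    (\<forall>q\<in>Q. \<exists>p\<in>T. dist q p \<le> 2 * r * length keys) \<and>
    (\<forall>key\<in>set keys. \<forall>p\<in>T. \<forall>q\<in>T. p \<noteq> q \<longrightarrow> key p = key q \<longrightarrow> 2 * r < dist p q)"
  using assms(1,2,6)
proof (induction keys arbitrary: c Q)
  case Nil
  have "fits M (2 * (s * s)) c" using Nil(1) by (auto simp: stores_def fits_def)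
  then show ?case using Nil by (intro exI[of _ Q]) auto
next
  case (Cons key keys)
  obtain W where W: "set W = Q" "distinct W" "sorted (map key W)" "legal M (2 * (s * s)) c (phase s l M r key)"
    "stores M (2 * (s * s)) (fold (advance M) (phase s l M r key) c) (survivors key r W)"
    using phase_run[OF Cons.prems(1,2) assms(3,4)] by blast
  let ?Q = "survivors key r W"
  have thin: "thin key r (set W)" using Cons.prems(3) W(1) by simp
  have sub: "?Q \<subseteq> Q" using survivors_subset W(1) by metis
  have fin: "finite Q" using Cons.prems(1) by (simp add: stores_def)
  have c1: "card ?Q \<le> M" using card_mono[OF fin sub] Cons.prems(2) by simp
  have c2: "\<forall>k\<in>set keys. thin k r ?Q"
    using Cons.prems(3) thin_subset[OF _ sub] by simp
  obtain T where T: "T \<subseteq> ?Q"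
    "legal M (2 * (s * s)) (fold (advance M) (phase s l M r key) c) (concat (map (phase s l M r) keys))"
    "stores M (2 * (s * s)) (fold (advance M) (concat (map (phase s l M r) keys)) (fold (advance M) (phase s l M r key) c)) T"
    "\<forall>q\<in>?Q. \<exists>p\<in>T. dist q p \<le> 2 * r * length keys"
    "\<forall>key\<in>set keys. \<forall>p\<in>T. \<forall>q\<in>T. p \<noteq> q \<longrightarrow> key p = key q \<longrightarrow> 2 * r < dist p q"
    using Cons.IH[OF W(5) c1 c2] by (elim exE conjE) (rule that, assumption+)
  have cov: "\<exists>p\<in>T. dist q p \<le> 2 * r * length (key # keys)" if q: "q \<in> Q" for q
  proof -
    obtain u where u: "u \<in> ?Q" "dist q u \<le> 2 * r"
      using survivors_cover[OF W(2,3) thin assms(5)] q W(1) by blast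
    obtain p where p: "p \<in> T" "dist u p \<le> 2 * r * length keys" using T(4) u(1) by blast
    have "dist q p \<le> dist q u + dist u p" by (rule dist_triangle)
    also have "\<dots> \<le> 2 * r * length (key # keys)" using u(2) p(2) by (simp add: algebra_simps)
    finally show ?thesis using p(1) by blast
  qed
  have "\<forall>p\<in>T. \<forall>q\<in>T. p \<noteq> q \<longrightarrow> key p = key q \<longrightarrow> 2 * r < dist p q"
    using survivors_separated[OF W(2,3) thin] T(1) by blast
  then have sep: "\<forall>k\<in>set (key # keys). \<forall>p\<in>T. \<forall>q\<in>T. p \<noteq> q \<longrightarrow> k p = k q \<longrightarrow> 2 * r < dist p q"
    using T(5) by simp
  have "legal M (2 * (s * s)) c (concat (map (phase s l M r) (key # keys)))"
    using legal_append[OF W(4) T(2)] by simp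
  moreover have "stores M (2 * (s * s)) (fold (advance M) (concat (map (phase s l M r) (key # keys))) c) T"
    using T(3) by simp
  ultimately show ?case using T(1) sub cov sep by (intro exI[of _ T]) blast
qed

section \<open>Grid cells and keys that bring close pairs together\<close>

definition cell :: "real \<Rightarrow> real ^ 'd \<Rightarrow> 'd \<Rightarrow> int" where
  "cell r p = (\<lambda>i. \<lfloor>p $ i * CARD('d) / r\<rfloor>)"

text \<open>Cells have side \<open>r / CARD('d)\<close>, so the sum norm of a difference, and with
  it the Euclidean norm, is at most \<open>r\<close>.\<close>

lemma cell_eq_dist:
  fixes p q :: "real ^ 'd"
  assumes "0 < r" "cell r p = cell r q"
  shows "dist p q \<le> r"
proof -
  have "\<bar>(p - q) $ i\<bar> \<le> r / CARD('d)" for i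
  proof -
    have "\<lfloor>p $ i * CARD('d) / r\<rfloor> = \<lfloor>q $ i * CARD('d) / r\<rfloor>"
      using assms(2) by (auto simp: cell_def dest: fun_cong)
    then have "\<bar>p $ i * CARD('d) / r - q $ i * CARD('d) / r\<bar> < 1" by linarith
    also have "p $ i * CARD('d) / r - q $ i * CARD('d) / r = (p - q) $ i * (CARD('d) / r)"
      by (simp add: left_diff_distrib diff_divide_distrib)
    finally have "\<bar>(p - q) $ i\<bar> * (CARD('d) / r) < 1" using assms(1) by (simp add: abs_mult)
    then show ?thesis using assms(1) by (simp add: field_simps)
  qed
  then have "(\<Sum>i\<in>UNIV. \<bar>(p - q) $ i\<bar>) \<le> (\<Sum>i\<in>(UNIV :: 'd set). r / CARD('d))" by (intro sum_mono)
  also have "\<dots> = r" by simp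
  finally show ?thesis using norm_le_l1_cart[of "p - q"] by (simp add: dist_norm)
qed

text \<open>Serves twice: with \<open>k = 2\<close> for pairs within \<open>2 * r\<close>, and with
  \<open>k = 4\<close> and \<open>r = 1 / 2\<close> for sets of diameter below 2.\<close>

lemma cell_near:
  fixes p q :: "real ^ 'd"
  assumes "0 < r" "dist p q \<le> real k * r"
  shows "\<bar>cell r p i - cell r q i\<bar> < int (k * CARD('d)) + 2"
proof -
  have "\<bar>(p - q) $ i\<bar> \<le> k * r" using component_le_norm_cart[of "p - q" i] assms(2) by (simp add: dist_norm)
  then have "\<bar>(p - q) $ i\<bar> * (CARD('d) / r) \<le> k * r * (CARD('d) / r)" using assms(1) by (intro mult_right_mono) auto
  also have "\<dots> = real (k * CARD('d))" using assms(1) by simp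
  finally have "\<bar>(p - q) $ i * (CARD('d) / r)\<bar> \<le> real (k * CARD('d))" using assms(1) by (simp add: abs_mult)
  moreover have "(p - q) $ i * (CARD('d) / r) = p $ i * CARD('d) / r - q $ i * CARD('d) / r"
    by (simp add: left_diff_distrib diff_divide_distrib)
  ultimately show ?thesis unfolding cell_def by linarith
qed

text \<open>Identifies \<open>z + v\<close> with \<open>z\<close> for the cells \<open>z\<close> in
  the residue class \<rho> modulo \<open>m\<close>: the cell \<open>z + v\<close> takes the name
  \<open>z\<close>, all others keep theirs.\<close>

definition pair_cells :: "int \<Rightarrow> ('d \<Rightarrow> int) \<times> ('d \<Rightarrow> int) \<Rightarrow> ('d \<Rightarrow> int) \<Rightarrow> 'd \<Rightarrow> int" where
  "pair_cells m = (\<lambda>(\<rho>, v) z. if (\<lambda>i. (z i - v i) mod m) = \<rho> then (\<lambda>i. z i - v i) else z)"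

text \<open>A name is borne by at most two cells: the cell of that name and its translate by
  \<open>v\<close>.\<close>

lemma pair_cells_fibre:
  assumes "pair_cells m x z = pair_cells m x w" "pair_cells m x w = pair_cells m x u"
  shows "z = w \<or> z = u \<or> w = u"
proof -
  obtain \<rho> v where x: "x = (\<rho>, v)" by fastforce
  have inj: "z = w" if "(\<lambda>i. z i - v i) = (\<lambda>i. w i - v i)" for z w
    using that by (auto simp: fun_eq_iff)
  show ?thesis
    using assms by (auto simp: pair_cells_def x split: if_splits dest: inj)
qed

text \<open>Any enumeration will do; it depends on \<open>m\<close> and the dimension alone, so its
  length is a constant.\<close>

definition offsets :: "int \<Rightarrow> (('d::finite \<Rightarrow> int) \<times> ('d \<Rightarrow> int)) list" where
  "offsets m = (SOME xs. set xs = (UNIV \<rightarrow> {0..<m}) \<times> (UNIV \<rightarrow> {-m<..<m}))"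

lemma finite_UNIV_Pi:
  fixes A :: "int set"
  assumes "finite A"
  shows "finite ((UNIV :: 'd::finite set) \<rightarrow> A)"
  using finite_PiE[of "UNIV :: 'd set" "\<lambda>_. A"] assms by (simp add: PiE_UNIV_domain)

lemma set_offsets: "set (offsets m :: (('d::finite \<Rightarrow> int) \<times> _) list) = (UNIV \<rightarrow> {0..<m}) \<times> (UNIV \<rightarrow> {-m<..<m})"
proof -
  have "finite ((UNIV \<rightarrow> {0..<m}) \<times> (UNIV \<rightarrow> {-m<..<m}) :: (('d \<Rightarrow> int) \<times> ('d \<Rightarrow> int)) set)"
    by (intro finite_cartesian_product finite_UNIV_Pi) simp_all
  from finite_list[OF this] show ?thesis
    unfolding offsets_def by (rule someI_ex)
qed

text \<open>Take \<open>v = w - z\<close> and the residues of \<open>z\<close>. Then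
  \<open>w\<close> is renamed to \<open>z\<close>, while \<open>z\<close> keeps its name: otherwise
  \<open>m\<close> would divide every coordinate of \<open>v\<close>, but one of them is nonzero and
  smaller than \<open>m\<close> in absolute value.\<close>

lemma pair_cells_meet:
  fixes z w :: "'d::finite \<Rightarrow> int"
  assumes "z \<noteq> w" "\<And>i. \<bar>z i - w i\<bar> < m"
  shows "\<exists>x\<in>set (offsets m). pair_cells m x z = pair_cells m x w"
proof -
  define v where "v i = w i - z i" for i
  define \<rho> where "\<rho> i = z i mod m" for i
  obtain i where "z i \<noteq> w i" using assms(1) by (auto simp: fun_eq_iff)
  then have i: "v i \<noteq> 0" by (simp add: v_def)
  have vm: "\<bar>v j\<bar> < m" for j using assms(2)[of j] by (simp add: v_def abs_minus_commute)
  have m: "0 < m" using vm[of i] by linarith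
  have "(z i - v i) mod m \<noteq> z i mod m"
  proof
    assume "(z i - v i) mod m = z i mod m"
    then have "m dvd v i" by (metis add_diff_cancel_left' diff_add_cancel dvd_minus_iff minus_diff_eq mod_eq_dvd_iff)
    then show False using zdvd_imp_le[of m "\<bar>v i\<bar>"] i vm[of i] by simp
  qed
  then have "pair_cells m (\<rho>, v) z = z" by (auto simp: pair_cells_def \<rho>_def fun_eq_iff)
  moreover have "pair_cells m (\<rho>, v) w = z" by (auto simp: pair_cells_def \<rho>_def v_def)
  moreover have "v j \<in> {-m<..<m}" for j using vm[of j] by (auto simp: abs_less_iff)
  then have "(\<rho>, v) \<in> set (offsets m)" unfolding set_offsets using m by (auto simp: \<rho>_def)
  ultimately show ?thesis by metis
qed

text \<open>The modulus is the bound of \<open>cell_near\<close> for \<open>k = 2\<close>, so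
  distinct cells of points within \<open>2 * r\<close> are merged by one of the keys.\<close>

definition keys :: "real \<Rightarrow> (real ^ 'd \<Rightarrow> nat) list" where
  "keys r = map (\<lambda>x p. to_nat (pair_cells (2 * int CARD('d) + 2) x (cell r p))) (offsets (2 * int CARD('d) + 2))"

definition algorithm :: "nat \<Rightarrow> nat \<Rightarrow> nat \<Rightarrow> real \<Rightarrow> (real ^ 'd) step list" where
  "algorithm s l M r = concat (map (phase s l M r) ((\<lambda>p. to_nat (cell r p)) # keys r))"

text \<open>The first pass leaves at most one point per cell, so the classes of the remaining keys
  have at most two points. After those passes a close pair would share some key, contrary to the
  separation for that key.\<close>

lemma algorithm_run:
  fixes P :: "(real ^ 'd) set"
  assumes "stores M (2 * (s * s)) c P" "card P \<le> M" "0 < s" "M = s ^ l" "0 < r"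
  shows "\<exists>T\<subseteq>P. legal M (2 * (s * s)) c (algorithm s l M r) \<and>
    stores M (2 * (s * s)) (fold (advance M) (algorithm s l M r) c) T \<and>
    (\<forall>p\<in>P. \<exists>q\<in>T. dist p q \<le> 2 * r * (length (offsets (2 * int CARD('d) + 2) :: (('d \<Rightarrow> int) \<times> _) list) + 1)) \<and>
    (\<forall>p\<in>T. \<forall>q\<in>T. p \<noteq> q \<longrightarrow> 2 * r < dist p q)"
proof -
  let ?key = "\<lambda>p :: real ^ 'd. to_nat (cell r p)" and ?S = "2 * (s * s)"
  have "thin ?key r P"
    using cell_eq_dist[OF assms(5)] assms(5) by (force simp: thin_def)
  then obtain Q where Q: "Q \<subseteq> P" "legal M ?S c (phase s l M r ?key)"
    "stores M ?S (fold (advance M) (phase s l M r ?key) c) Q"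
    "\<forall>p\<in>P. \<exists>q\<in>Q. dist p q \<le> 2 * r"
    "\<forall>p\<in>Q. \<forall>q\<in>Q. p \<noteq> q \<longrightarrow> ?key p = ?key q \<longrightarrow> 2 * r < dist p q"
    using phases_run[OF assms(1-4), of r "[?key]"] assms(5) by auto
  have inj: "p = q" if "p \<in> Q" "q \<in> Q" "cell r p = cell r q" for p q
    using Q(5) that cell_eq_dist[OF assms(5) that(3)] assms(5) by force
  \<comment> \<open>The condition is vacuous: by \<open>pair_cells_fibre\<close> three points with a
    common key include two in one cell, and these coincide.\<close>
  have thinQ: "thin key r Q" if kin: "key \<in> set (keys r)" for key
    unfolding thin_def
  proof (intro ballI impI)
    fix p q u assume pqu: "p \<in> Q" "q \<in> Q" "u \<in> Q" "key p = key q" "key q = key u" "p \<noteq> q" "p \<noteq> u" "q \<noteq> u"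
    obtain x where x: "key = (\<lambda>p. to_nat (pair_cells (2 * int CARD('d) + 2) x (cell r p)))"
      using kin unfolding keys_def set_map by blast
    have "cell r p = cell r q \<or> cell r p = cell r u \<or> cell r q = cell r u"
      using pqu(4,5) unfolding x by (intro pair_cells_fibre[of "2 * int CARD('d) + 2" x]) simp_all
    then show "dist p q \<le> 2 * r" using inj pqu by blast
  qed
  then have thinQ': "\<forall>key\<in>set (keys r). thin key r Q" by blast
  have finP: "finite P" using assms(1) by (simp add: stores_def)
  have cQ: "card Q \<le> M" using card_mono[OF finP Q(1)] assms(2) by simp
  obtain T where T: "T \<subseteq> Q" "legal M ?S (fold (advance M) (phase s l M r ?key) c) (concat (map (phase s l M r) (keys r)))"
    "stores M ?S (fold (advance M) (concat (map (phase s l M r) (keys r))) (fold (advance M) (phase s l M r ?key) c)) T"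
    "\<forall>q\<in>Q. \<exists>p\<in>T. dist q p \<le> 2 * r * length (keys r :: (real ^ 'd \<Rightarrow> nat) list)"
    "\<forall>key\<in>set (keys r). \<forall>p\<in>T. \<forall>q\<in>T. p \<noteq> q \<longrightarrow> key p = key q \<longrightarrow> 2 * r < dist p q"
    using phases_run[OF Q(3) cQ assms(3,4) less_imp_le[OF assms(5)] thinQ']
    by (elim exE conjE) (rule that, assumption+)
  have "2 * r < dist p q" if pq: "p \<in> T" "q \<in> T" "p \<noteq> q" for p q
  proof (rule ccontr)
    assume near: "\<not> 2 * r < dist p q"
    have "cell r p \<noteq> cell r q" using inj T(1) pq by blast
    then obtain x where x: "x \<in> set (offsets (2 * int CARD('d) + 2))"
      "pair_cells (2 * int CARD('d) + 2) x (cell r p) = pair_cells (2 * int CARD('d) + 2) x (cell r q)"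
      using pair_cells_meet[of "cell r p" "cell r q" "2 * int CARD('d) + 2"]
        cell_near[OF assms(5), of p q 2] near by auto
    define key where "key = (\<lambda>p :: real ^ 'd. to_nat (pair_cells (2 * int CARD('d) + 2) x (cell r p)))"
    have "key \<in> set (keys r)" "key p = key q" using x by (auto simp: keys_def key_def)
    then show False using T(5) pq near by blast
  qed
  moreover have "\<exists>q\<in>T. dist p q \<le> 2 * r * (length (offsets (2 * int CARD('d) + 2) :: (('d \<Rightarrow> int) \<times> _) list) + 1)"
    if p: "p \<in> P" for p
  proof -
    obtain u where u: "u \<in> Q" "dist p u \<le> 2 * r" using Q(4) p by blast
    obtain q where q: "q \<in> T" "dist u q \<le> 2 * r * length (keys r :: (real ^ 'd \<Rightarrow> nat) list)" using T(4) u(1) by blast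
    have "dist p q \<le> dist p u + dist u q" by (rule dist_triangle)
    also have "\<dots> \<le> 2 * r * (length (offsets (2 * int CARD('d) + 2) :: (('d \<Rightarrow> int) \<times> _) list) + 1)"
      using u(2) q(2) by (simp add: keys_def algebra_simps)
    finally show ?thesis using q(1) by blast
  qed
  moreover have "legal M ?S c (algorithm s l M r)"
    using legal_append[OF Q(2) T(2)] by (simp add: algorithm_def)
  moreover have "stores M ?S (fold (advance M) (algorithm s l M r) c) T"
    using T(3) by (simp add: algorithm_def)
  moreover have "T \<subseteq> P" using T(1) Q(1) by blast
  ultimately show ?thesis by blast
qed

text \<open>Two points of one cluster are within \<open>2 * r\<close> by way of its centre, so
  sending each point of \<open>T\<close> to its cluster is injective.\<close>

lemma separated_card_le:
  assumes "finite P" "P \<noteq> {}" "min_clustering P r \<C>" "T \<subseteq> P"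
    and sep: "\<And>p q. p \<in> T \<Longrightarrow> q \<in> T \<Longrightarrow> p \<noteq> q \<Longrightarrow> 2 * r < dist p q"
  shows "card T \<le> card \<C>"
proof -
  have part: "partition_on P \<C>" and cost: "clustering_cost \<C> \<le> r"
    using assms(3) by (auto simp: min_clustering_def is_arg_min_def)
  have fin: "finite \<C>" using part assms(1) by (meson finite_elements)
  have radius: "\<exists>x. \<forall>y\<in>X. dist x y \<le> r" if X: "X \<in> \<C>" for X
  proof -
    have "finite X" "X \<noteq> {}" using part X assms(1) by (auto simp: partition_on_def intro: rev_finite_subset)
    have "cluster_radius X \<le> clustering_cost \<C>" unfolding clustering_cost_def using fin X by simp
    then have "Min ((\<lambda>x. Max (dist x ` X)) ` X) \<le> r" using cost by (simp add: cluster_radius_def)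
    then obtain x where "x \<in> X" "Max (dist x ` X) \<le> r"
      using \<open>finite X\<close> \<open>X \<noteq> {}\<close> by (auto simp: Min_le_iff)
    then show ?thesis using \<open>finite X\<close> \<open>X \<noteq> {}\<close> by auto
  qed
  have "\<forall>p\<in>T. \<exists>X\<in>\<C>. p \<in> X" using part assms(4) by (auto simp: partition_on_def)
  then obtain F where F: "\<And>p. p \<in> T \<Longrightarrow> F p \<in> \<C> \<and> p \<in> F p" by metis
  have "inj_on F T"
  proof (rule inj_onI, rule ccontr)
    fix p q assume pq: "p \<in> T" "q \<in> T" "F p = F q" "p \<noteq> q"
    obtain x where "\<forall>y\<in>F p. dist x y \<le> r" using radius F[OF pq(1)] by blast
    then have "dist x p \<le> r" "dist x q \<le> r" using F[OF pq(1)] F[OF pq(2)] pq(3) by auto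
    then have "dist p q \<le> 2 * r" using dist_triangle3[of p q x] by linarith
    then show False using sep[OF pq(1,2,4)] by simp
  qed
  then show ?thesis using F fin by (intro card_inj_on_le[of F]) auto
qed

lemma COST_le:
  assumes "finite P" "P \<noteq> {}" "T \<subseteq> P" "\<And>p. p \<in> P \<Longrightarrow> \<exists>q\<in>T. dist p q \<le> b"
  shows "COST P T \<le> b"
proof -
  have "finite T" using assms finite_subset by blast
  have "Min (dist p ` T) \<le> b" if p: "p \<in> P" for p
  proof -
    obtain q where q: "q \<in> T" "dist p q \<le> b" using assms(4)[OF p] by blast
    then have "Min (dist p ` T) \<le> dist p q" using \<open>finite T\<close> by simp
    then show ?thesis using q by simp
  qed
  then show ?thesis unfolding COST_def using assms by simp
qed

section \<open>Parameters\<close>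

text \<open>The number of routings depends on the depth alone, so at fixed depth the number of
  rounds does not grow with \<open>n\<close>.\<close>

lemma length_net: "length (net B s l) = length (net B' s' l)"
  by (induction l) (simp_all add: Let_def)

text \<open>The summand 1 is the pass with the cell as key; the summand 3 counts the spreading,
  copying and dropping steps of a pass.\<close>

lemma length_algorithm:
  "length (algorithm s l M r :: (real ^ 'd) step list) =
    (length (offsets (2 * int CARD('d) + 2) :: (('d \<Rightarrow> int) \<times> _) list) + 1) * (length (net 0 0 l) + 3)"
proof -
  have p: "length (phase s l M r key) = length (net 0 0 l) + 3" for key :: "real ^ 'd \<Rightarrow> nat"
    using length_net[of "2 * (s * s)" s l 0 0] by (simp add: phase_def)
  have "length (concat (map (phase s l M r) ks)) = length ks * (length (net 0 0 l) + 3)"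
    for ks :: "(real ^ 'd \<Rightarrow> nat) list"
    by (induction ks) (simp_all add: p)
  then show ?thesis unfolding algorithm_def by (simp only:) (simp add: keys_def)
qed

lemma input_on_stores:
  assumes "input_on M S P inp" "finite P"
  shows "stores M S (\<lambda>i. (inp i, [])) P"
proof -
  define un :: "'a word \<Rightarrow> 'a" where "un w = (case w of Pt p \<Rightarrow> p | Num _ \<Rightarrow> undefined)" for w
  have m: "mset (concat (map inp [0..<M])) = image_mset Pt (mset_set P)"
    and len: "\<And>i. i < M \<Longrightarrow> length (inp i) \<le> S"
    using assms(1) by (auto simp: input_on_def)
  have "set (concat (map inp [0..<M])) = Pt ` P"
    using arg_cong[OF m, of set_mset] assms(2) by (simp del: set_concat)
  then have mem: "w \<in> Pt ` P" if "i < M" "w \<in> set (inp i)" for i w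
    using that by (metis (no_types, lifting) UN_I atLeast0LessThan atLeastLessThan_upt imageI lessThan_iff list.set_map set_concat)
  have inp: "inp i = map Pt (map un (inp i))" if "i < M" for i
  proof -
    have "Pt (un w) = w" if w: "w \<in> set (inp i)" for w
    proof -
      obtain p where "w = Pt p" using mem[OF \<open>i < M\<close> w] by blast
      then show ?thesis by (simp add: un_def)
    qed
    then have "map (Pt \<circ> un) (inp i) = inp i" by (intro map_idI) simp
    then show ?thesis by (simp only: map_map)
  qed
  have "(\<Sum>i<M. mset (map un (inp i))) = image_mset un (mset (concat (map inp [0..<M])))"
    by (induction M) simp_all
  also have "\<dots> = mset_set P"
    unfolding m by (simp add: multiset.map_comp comp_def un_def)
  finally show ?thesis
    unfolding stores_def using assms(2) inp len by (intro conjI exI[of _ "\<lambda>i. map un (inp i)"]) auto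
qed

lemma output_points_stores:
  assumes "stores M S c T"
  shows "output_points M c = T"
proof -
  obtain L where L: "\<And>i. i < M \<Longrightarrow> c i = (map Pt (L i), [])" "(\<Sum>i<M. mset (L i)) = mset_set T"
    and fin: "finite T" using assms by (auto simp: stores_def)
  have "output_points M c = (\<Union>i<M. set (L i))"
    using L(1) by (auto simp: output_points_def points_def)
  also have "\<dots> = set_mset (\<Sum>i<M. mset (L i))" by (simp add: set_mset_sum)
  finally show ?thesis using L(2) fin by simp
qed

lemma min_distance_le:
  assumes "finite P" "x \<in> P" "y \<in> P" "x \<noteq> y"
  shows "min_distance P \<le> dist x y"
proof -
  have "{dist x y | x y. x \<in> P \<and> y \<in> P \<and> x \<noteq> y} \<subseteq> (\<lambda>(x, y). dist x y) ` (P \<times> P)" by auto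
  then have "finite {dist x y | x y. x \<in> P \<and> y \<in> P \<and> x \<noteq> y}"
    using assms(1) by (meson finite_SigmaI finite_imageI finite_subset)
  then show ?thesis unfolding min_distance_def using assms by (intro Min_le) auto
qed

text \<open>Packing: for \<open>r = 1 / 2\<close>, points at mutual distance at least 1 lie in
  different cells, and a set of diameter below 2 meets boundedly many cells. This keeps the factor
  \<open>log 2 (diameter P)\<close> of the global space at least 1.\<close>

lemma diameter_ge_2:
  "\<exists>n\<^sub>0. \<forall>P :: (real ^ 'd) set. finite P \<and> min_distance P = 1 \<and> n\<^sub>0 \<le> card P \<longrightarrow> 2 \<le> diameter P"
proof -
  define m where "m = int (4 * CARD('d)) + 2"
  define X where "X = ((UNIV :: 'd set) \<rightarrow> {-m<..<m})"
  have X: "finite X" by (simp add: X_def finite_UNIV_Pi)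
  show ?thesis
  proof (intro exI[of _ "Suc (card X)"] allI impI, rule ccontr)
    fix P :: "(real ^ 'd) set"
    assume P: "finite P \<and> min_distance P = 1 \<and> Suc (card X) \<le> card P" and small: "\<not> 2 \<le> diameter P"
    obtain p0 where p0: "p0 \<in> P" using P by fastforce
    define F where "F p i = cell (1 / 2) p i - cell (1 / 2) p0 i" for p :: "real ^ 'd" and i
    have "inj_on F P"
    proof (rule inj_onI, rule ccontr)
      fix p q assume pq: "p \<in> P" "q \<in> P" "F p = F q" "p \<noteq> q"
      have "cell (1 / 2) p = cell (1 / 2) q" using pq(3) by (auto simp: F_def fun_eq_iff)
      then have "dist p q \<le> 1 / 2" by (intro cell_eq_dist) auto
      then show False using min_distance_le[of P p q] P pq by simp
    qed
    moreover have "F ` P \<subseteq> X"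
    proof
      fix f assume "f \<in> F ` P"
      then obtain p where p: "p \<in> P" "f = F p" by blast
      have "dist p p0 \<le> diameter P"
        using P p p0 by (intro diameter_bounded_bound finite_imp_bounded) auto
      then have "dist p p0 \<le> real 4 * (1 / 2)" using small by simp
      then have "\<bar>F p i\<bar> < m" for i unfolding F_def m_def by (intro cell_near) auto
      then show "f \<in> X" unfolding X_def p(2) by (auto simp: abs_less_iff minus_less_iff)
    qed
    ultimately have "card P \<le> card X" using X by (rule card_inj_on_le)
    then show False using P by simp
  qed
qed

text \<open>Once the logarithm is at least 1, so is the hidden factor
  \<open>C * log 2 f powr C\<close>, which then may multiply or divide.\<close>

lemma soft_Theta_self:
  assumes "1 \<le> C" "1 \<le> log 2 f" "0 \<le> f"
  shows "soft_Theta C f f"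
proof -
  have "1 * 1 \<le> C * log 2 f powr C"
    using assms by (intro mult_mono ge_one_powr_ge_zero) auto
  then have c: "1 \<le> C * log 2 f powr C" by simp
  have "f / (C * log 2 f powr C) \<le> f" using c assms(3) by (simp add: divide_le_eq mult_le_cancel_left1)
  moreover have "f * 1 \<le> f * (C * log 2 f powr C)" using c assms(3) by (rule mult_left_mono)
  then have "f \<le> C * f * log 2 f powr C" by (simp add: mult_ac)
  ultimately show ?thesis by (simp add: soft_Theta_def soft_O_def)
qed

lemma ilog_gt_1: "i < log_star x \<Longrightarrow> 1 < ilog i x"
  unfolding log_star_def using not_less_Least not_le by blast

lemma size_bounds:
  fixes n D :: nat
  assumes "1 \<le> n" "1 \<le> D"
  defines "s \<equiv> nat \<lceil>real n powr (1 / D)\<rceil>"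
  shows "0 < s" "n \<le> s ^ D" "real (2 * (s * s)) \<le> 8 * real n powr (2 / D)"
    "real (2 * (s * s) * s ^ D) \<le> 2 ^ (D + 3) * real n powr (1 + 2 / D)"
proof -
  define x where "x = real n powr (1 / D)"
  have x1: "1 \<le> x" unfolding x_def using assms by (intro ge_one_powr_ge_zero) auto
  have xs: "x \<le> s" unfolding s_def x_def[symmetric] by linarith
  \<comment> \<open>Rounding up at most doubles a real that is at least 1; the powers of 2 in the
    bounds come from here.\<close>
  have sx: "s \<le> 2 * x" unfolding s_def x_def[symmetric] using x1 by linarith
  have xk: "x ^ k = real n powr (k / D)" for k
    using assms(1) by (simp add: x_def powr_powr flip: powr_realpow)
  show "0 < s" using xs x1 by linarith
  have "real n = x ^ D" using xk[of D] assms by simp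
  also have "\<dots> \<le> real s ^ D" using xs x1 by (intro power_mono) auto
  finally show "n \<le> s ^ D" by (metis of_nat_le_iff of_nat_power)
  have "real (2 * (s * s)) = 2 * real s ^ 2" by (simp add: power2_eq_square)
  also have "\<dots> \<le> 2 * (2 * x) ^ 2" using sx by (intro mult_left_mono power_mono) auto
  also have "\<dots> = 8 * x ^ 2" by (simp add: power2_eq_square)
  finally show "real (2 * (s * s)) \<le> 8 * real n powr (2 / D)" by (simp add: xk)
  have "real (2 * (s * s) * s ^ D) = 2 * real s ^ (D + 2)" by (simp add: power_add power2_eq_square)
  also have "\<dots> \<le> 2 * (2 * x) ^ (D + 2)" using sx by (intro mult_left_mono power_mono) auto
  also have "\<dots> = 2 ^ (D + 3) * x ^ (D + 2)" by (simp add: power_mult_distrib power_add power3_eq_cube)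
  also have "real (D + 2) / D = 1 + 2 / D" using assms(2) by (simp add: field_simps)
  then have "x ^ (D + 2) = real n powr (1 + 2 / D)" by (simp only: xk)
  finally show "real (2 * (s * s) * s ^ D) \<le> 2 ^ (D + 3) * real n powr (1 + 2 / D)" .
qed

section \<open>Choice of the parameters and proof of the bounds\<close>

theorem mainTheorem3:
  fixes \<delta> \<rho> :: real
  assumes "0 < \<delta>" and "\<delta> < 1" and "0 < \<rho>"
  shows "\<exists>(c::real) (c\<^sub>0::nat) (b::nat) (C::real) (\<epsilon>::real)
            (S :: nat \<Rightarrow> nat) (M :: nat \<Rightarrow> real \<Rightarrow> nat) (R :: nat \<Rightarrow> nat)
            (alg :: nat \<Rightarrow> nat \<Rightarrow> nat \<Rightarrow> real \<Rightarrow> (real ^ 'd) program).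
     0 < C \<and> 0 < \<epsilon> \<and>
     (\<forall>K>0. \<exists>n\<^sub>0. \<forall>n\<ge>n\<^sub>0. \<forall>(\<alpha>::nat) (r::real) (P :: (real ^ 'd) set) \<C>.
        1 \<le> \<alpha> \<and> \<alpha> + c\<^sub>0 \<le> log_star n \<and> 0 < r \<and>
        finite P \<and> card P = n \<and> min_distance P = 1 \<and>
        min_clustering P r \<C> \<and> real (card \<C>) \<ge> K * log 2 n powr c
        \<longrightarrow>
        (let \<Delta> = diameter P; m = M n \<Delta>; s = S n; prog = alg n m \<alpha> r in
          n \<le> s * m \<and>
          real s \<le> C * real n powr \<delta> \<and>
          soft_O C (real n powr (1 + \<rho>) * log 2 \<Delta>) (real (s * m)) \<and>
          real (R n) \<le> C * log 2 (log 2 n) \<and>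
          (\<exists>\<theta>\<^sub>1 \<theta>\<^sub>2.
             soft_Theta C (ilog \<alpha> n) \<theta>\<^sub>1 \<and> soft_Theta C (ilog \<alpha> n ^ 3) \<theta>\<^sub>2 \<and>
             (\<forall>inp. input_on m s P inp \<longrightarrow>
                respects_MPC m s b prog inp (R n) \<and>
                measure_pmf.prob (run m prog inp (R n))
                  {cfg. let T = output_points m cfg in
                     T \<subseteq> P \<and> T \<noteq> {} \<and>
                     COST P T \<le> C * (r * (real \<alpha> + ilog (\<alpha> + 1) n)) \<and>
                     real (card T) \<le> real (card \<C>) * (1 + 1 / \<theta>\<^sub>1) + \<theta>\<^sub>2}
                  \<ge> 1 - 1 / ilog (\<alpha> - 1) n powr \<epsilon>))))"
proof -
  \<comment> \<open>Depth of the recursion, large enough for the exponent \<open>2 / D\<close> of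
    the local space, which is also the excess exponent of the global space, to be at most \<delta>
    and \<rho>.\<close>
  define D where "D = nat \<lceil>2 / \<delta> + 2 / \<rho>\<rceil>"
  have D: "2 / \<delta> + 2 / \<rho> \<le> D" "0 < 2 / \<delta>" "0 < 2 / \<rho>" using assms by (simp_all add: D_def real_nat_ceiling_ge)
  have D1: "1 \<le> D" using D by linarith
  have Dd: "2 / real D \<le> \<delta>"
  proof -
    have "2 / \<delta> \<le> D" using D by linarith
    then show ?thesis using assms(1) D1 by (simp add: field_simps)
  qed
  have Dr: "2 / real D \<le> \<rho>"
  proof -
    have "2 / \<rho> \<le> D" using D by linarith
    then show ?thesis using assms(3) D1 by (simp add: field_simps)
  qed
  define N where "N = length (offsets (2 * int CARD('d) + 2) :: (('d \<Rightarrow> int) \<times> _) list)"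
  define R where "R = (N + 1) * (length (net 0 0 D) + 3)"
  \<comment> \<open>One constant for all bounds: \<open>2 ^ (D + 3)\<close> for the space,
    \<open>2 * (N + 1)\<close> for the covering radius in units of \<open>r\<close>, and
    \<open>R\<close> for the rounds.\<close>
  define C :: real where "C = 2 ^ (D + 3) + 2 * (N + 1) + R + 1"
  define s where "s n = nat \<lceil>real n powr (1 / D)\<rceil>" for n :: nat
  define S where "S n = 2 * (s n * s n)" for n
  define M where "M n (\<Delta> :: real) = s n ^ D" for n \<Delta>
  define alg :: "nat \<Rightarrow> nat \<Rightarrow> nat \<Rightarrow> real \<Rightarrow> (real ^ 'd) program"
    where "alg n m \<alpha> r = prog_of (algorithm (s n) D m r)" for n m \<alpha> r
  have C: "1 \<le> C" "8 \<le> C" "2 ^ (D + 3) \<le> C" "2 * (real N + 1) \<le> C" "real R \<le> C"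
  proof -
    have "(2::real) ^ 3 \<le> 2 ^ (D + 3)" by (rule power_increasing) auto
    then show "1 \<le> C" "8 \<le> C" "2 ^ (D + 3) \<le> C" "2 * (real N + 1) \<le> C" "real R \<le> C"
      unfolding C_def by simp_all
  qed
  obtain n1 where n1: "\<And>P :: (real ^ 'd) set. finite P \<Longrightarrow> min_distance P = 1 \<Longrightarrow> n1 \<le> card P \<Longrightarrow> 2 \<le> diameter P"
    using diameter_ge_2 by blast
  have main: "n \<le> S n * m \<and> real (S n) \<le> C * real n powr \<delta> \<and>
      soft_O C (real n powr (1 + \<rho>) * log 2 (diameter P)) (real (S n * m)) \<and>
      real R \<le> C * log 2 (log 2 n) \<and>
      (\<exists>\<theta>\<^sub>1 \<theta>\<^sub>2.
         soft_Theta C (ilog \<alpha> n) \<theta>\<^sub>1 \<and> soft_Theta C (ilog \<alpha> n ^ 3) \<theta>\<^sub>2 \<and>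
         (\<forall>inp. input_on m (S n) P inp \<longrightarrow>
            respects_MPC m (S n) 1 (alg n m \<alpha> r) inp R \<and>
            measure_pmf.prob (run m (alg n m \<alpha> r) inp R)
              {cfg. let T = output_points m cfg in
                 T \<subseteq> P \<and> T \<noteq> {} \<and>
                 COST P T \<le> C * (r * (real \<alpha> + ilog (\<alpha> + 1) n)) \<and>
                 real (card T) \<le> real (card \<C>) * (1 + 1 / \<theta>\<^sub>1) + \<theta>\<^sub>2}
              \<ge> 1 - 1 / ilog (\<alpha> - 1) n powr 1))"
    if n: "max 16 n1 \<le> n" and \<alpha>: "1 \<le> \<alpha>" "\<alpha> + 2 \<le> log_star n" and r: "0 < r"
      and P: "finite P" "card P = n" "min_distance P = 1" "min_clustering P r \<C>"
      and m: "m = M n (diameter P)"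
    for n m \<alpha> r and P :: "(real ^ 'd) set" and \<C>
  proof -
    have n16: "16 \<le> n" "1 \<le> n" using n by auto
    note sb = size_bounds[OF n16(2) D1, folded s_def]
    have m': "m = s n ^ D" by (simp add: m M_def)
    have "n * 1 \<le> s n ^ D * S n" using sb(1,2) by (intro mult_mono) (auto simp: S_def)
    then have b1: "n \<le> S n * m" by (simp add: m' mult.commute)
    have "real (S n) \<le> 8 * real n powr (2 / D)" using sb(3) by (simp add: S_def)
    also have "\<dots> \<le> C * real n powr \<delta>"
      using n16 Dd C by (intro mult_mono powr_mono) auto
    finally have b2: "real (S n) \<le> C * real n powr \<delta>" .
    have dia: "2 \<le> diameter P" using n1 P n by simp
    then have "log 2 2 \<le> log 2 (diameter P)" by (subst log_le_cancel_iff) auto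
    then have ld: "1 \<le> log 2 (diameter P)" by simp
    define F where "F = real n powr (1 + \<rho>) * log 2 (diameter P)"
    have nF: "real n powr (1 + \<rho>) \<le> F" using ld mult_left_mono[OF ld, of "real n powr (1 + \<rho>)"] by (simp add: F_def)
    have "real n powr 1 \<le> real n powr (1 + \<rho>)" using n16 assms(3) by (intro powr_mono) auto
    then have F2: "2 \<le> F" using nF n16 by simp
    then have "log 2 2 \<le> log 2 F" by (subst log_le_cancel_iff) auto
    then have lF: "1 \<le> log 2 F powr C" using C by (intro ge_one_powr_ge_zero) auto
    have "real (S n * m) \<le> 2 ^ (D + 3) * real n powr (1 + 2 / D)" using sb(4) by (simp add: S_def m')
    also have "\<dots> \<le> C * real n powr (1 + \<rho>)"
      using n16 Dr C by (intro mult_mono powr_mono) auto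
    also have "\<dots> \<le> C * F" using nF C by (intro mult_left_mono) auto
    also have "\<dots> \<le> C * F * log 2 F powr C"
      using mult_left_mono[OF lF, of "C * F"] C F2 by simp
    finally have b3: "soft_O C F (real (S n * m))" by (simp add: soft_O_def)
    \<comment> \<open>From \<open>n \<ge> 16\<close> the double logarithm is at least 1, so a
      constant number of rounds is within the bound.\<close>
    have "log 2 (2 ^ 4) \<le> log 2 (real n)" using n16 by (subst log_le_cancel_iff) auto
    then have "4 \<le> log 2 (real n)" by (simp only: log_pow_cancel)
    then have "log 2 2 \<le> log 2 (log 2 (real n))" by (subst log_le_cancel_iff) auto
    then have "C * 1 \<le> C * log 2 (log 2 n)" using C by (intro mult_left_mono) auto
    then have b4: "real R \<le> C * log 2 (log 2 n)" using C by linarith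
    \<comment> \<open>The slack 2 below \<open>log_star n\<close> makes both \<open>?f\<close> and
      its logarithm exceed 1. The witnesses \<open>\<theta>\<^sub>1\<close> and
      \<open>\<theta>\<^sub>2\<close> are \<open>?f\<close> and \<open>?f ^ 3\<close>.\<close>
    let ?f = "ilog \<alpha> (real n)"
    have f: "1 < ?f" "1 < log 2 ?f"
      using ilog_gt_1[of \<alpha> "real n"] ilog_gt_1[of "Suc \<alpha>" "real n"] \<alpha> by auto
    have t1: "soft_Theta C ?f ?f" using f C by (intro soft_Theta_self) auto
    have t2: "soft_Theta C (?f ^ 3) (?f ^ 3)" 
    proof (rule soft_Theta_self[OF C(1)])
      have "log 2 (?f ^ 3) = 3 * log 2 ?f" using f by (simp add: log_nat_power)
      then show "1 \<le> log 2 (?f ^ 3)" using f(2) by linarith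
    qed (use f in simp)
    have main: "respects_MPC m (S n) 1 (alg n m \<alpha> r) inp R \<and>
        measure_pmf.prob (run m (alg n m \<alpha> r) inp R)
          {cfg. let T = output_points m cfg in
             T \<subseteq> P \<and> T \<noteq> {} \<and>
             COST P T \<le> C * (r * (real \<alpha> + ilog (\<alpha> + 1) n)) \<and>
             real (card T) \<le> real (card \<C>) * (1 + 1 / ?f) + ?f ^ 3}
          \<ge> 1 - 1 / ilog (\<alpha> - 1) n powr 1" (is "_ \<and> measure_pmf.prob _ ?G \<ge> _")
      if inp: "input_on m (S n) P inp" for inp
    proof -
      let ?sts = "algorithm (s n) D m r :: (real ^ 'd) step list" and ?c = "\<lambda>i. (inp i, [])"
      have st: "stores m (2 * (s n * s n)) ?c P" using input_on_stores[OF inp P(1)] by (simp add: S_def)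
      have cm: "card P \<le> m" using sb(2) P(2) by (simp add: m')
      obtain T where T: "T \<subseteq> P" "legal m (2 * (s n * s n)) ?c ?sts"
        "stores m (2 * (s n * s n)) (fold (advance m) ?sts ?c) T"
        "\<forall>p\<in>P. \<exists>q\<in>T. dist p q \<le> 2 * r * (N + 1)"
        "\<forall>p\<in>T. \<forall>q\<in>T. p \<noteq> q \<longrightarrow> 2 * r < dist p q"
        using algorithm_run[OF st cm sb(1) m' r] unfolding N_def by blast
      have len: "length ?sts = R" by (simp add: length_algorithm R_def N_def)
      have "respects_MPC m (S n) 1 (alg n m \<alpha> r) inp R"
        using legal_respects_MPC[OF T(2), of 1] by (simp add: alg_def S_def len)
      moreover have "fold (advance m) ?sts ?c \<in> ?G"
      proof -
        have P0: "P \<noteq> {}" using P(2) n16 by auto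
        have "T \<noteq> {}" using T(4) P0 by blast
        have "COST P T \<le> 2 * r * (N + 1)"
          using P(1) P0 T(1,4) by (intro COST_le) auto
        also have "\<dots> = (2 * (real N + 1)) * (r * 1)" by simp
        also have "\<dots> \<le> C * (r * (real \<alpha> + ilog (\<alpha> + 1) n))"
        proof (intro mult_mono mult_left_mono)
          have "1 \<le> real \<alpha>" "ilog (\<alpha> + 1) n = log 2 ?f" using \<alpha> by simp_all
          then show "1 \<le> real \<alpha> + ilog (\<alpha> + 1) n" using f(2) by linarith
        qed (use C r in simp_all)
        finally have cost: "COST P T \<le> C * (r * (real \<alpha> + ilog (\<alpha> + 1) n))" .
        have "card T \<le> card \<C>" using T(5) by (intro separated_card_le[OF P(1) P0 P(4) T(1)]) auto
        then have "real (card T) \<le> real (card \<C>) + 0" by simp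
        also have "\<dots> \<le> real (card \<C>) * (1 + 1 / ?f) + ?f ^ 3"
          using f by (intro add_mono) (auto simp: distrib_left)
        finally show ?thesis using output_points_stores[OF T(3)] T(1) \<open>T \<noteq> {}\<close> cost by (simp add: Let_def)
      qed
      \<comment> \<open>The run is a point mass at a configuration in \<open>?G\<close>.\<close>
      then have "measure_pmf.prob (run m (alg n m \<alpha> r) inp R) ?G = 1"
        using run_prog_of[of R ?sts m inp] by (simp add: alg_def len measure_return_pmf)
      ultimately show ?thesis by simp
    qed
    show ?thesis using b1 b2 b3[unfolded F_def] b4 t1 t2 main by blast
  qed
  \<comment> \<open>The values are \<open>c = 0\<close>, \<open>c\<^sub>0 = 2\<close>,
    \<open>b = 1\<close> and \<open>\<epsilon> = 1\<close>; as success has probability 1, every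
    positive \<open>\<epsilon>\<close> would do.\<close>
  show ?thesis
    apply (rule exI[of _ 0], rule exI[of _ 2], rule exI[of _ 1], rule exI[of _ C], rule exI[of _ 1],
      rule exI[of _ S], rule exI[of _ M], rule exI[of _ "\<lambda>_. R"], rule exI[of _ alg])
    apply (intro conjI allI impI exI[of _ "max 16 n1"])
    subgoal using C by simp
    subgoal by simp
    subgoal
      unfolding Let_def by (elim conjE, rule main[OF _ _ _ _ _ _ _ _ refl, unfolded Let_def]; assumption)
    done
qed

end
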